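(* Let $n\ge2$ and let $(\mathcal V_1,\dots,\mathcal V_n)$ be a factorization of the right shift semigroup $(S_t)_{t\ge0}$ on $L^2(\mathbb R_+)$. Then there is a unique pair $(\underline a,\underline b)\in\mathbb R^n\times\mathbb R_+^n$ with $\sum_{j=1}^na_j=0$ and $\underline b$ majorized by $(1,0,\dots,0)$ such that $V_{j,t}=e^{ia_jt}S_{b_jt}$ for all $t\ge0$ and $j=1,\dots,n$.
   Context: The right shift semigroup is $(S_tf)(x)=f(x-t)$ for $x\ge t$ and $0$ otherwise. A semigroup is a strongly continuous one-parameter semigroup of contractions; $(\mathcal V_1,\dots,\mathcal V_n)$, $\mathcal V_j=(V_{j,t})_{t\ge0}$, is a factorization of $(S_t)$ if $V_{j,t}V_{k,t}=V_{k,t}V_{j,t}$ for all $j,k,t$ and $S_t=V_{1,t}\cdots V_{n,t}$ for all $t\ge0$. A tuple $(x_1,\dots,x_n)$ is majorized by $(y_1,\dots,y_n)$ if $\sum_{j=1}^kx_j\le\sum_{j=1}^ky_j$ for all $k$ and $\sum_{j=1}^nx_j=\sum_{j=1}^ny_j$; for $\underline b\in\mathbb R_+^n$ majorization by $(1,0,\dots,0)$ means $b_j\ge0$ and $\sum_j b_j=1$. *)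

theory Defs
  imports "HOL-Analysis.Analysis"
begin

text \<open>Model of L^2(R_+): functions real => complex (values on negative reals irrelevant),
  square integrable on [0,oo), identified up to a.e. equality on [0,oo).
  Operators are maps on representatives that respect this identification.\<close>

type_synonym fn = "real \<Rightarrow> complex"
type_synonym op = "fn \<Rightarrow> fn"

definition L2 :: "fn set" where
  "L2 = {f. f \<in> borel_measurable lborel \<and>
            integrable lborel (\<lambda>x. indicator {0..} x * (cmod (f x))\<^sup>2)}"

definition l2norm :: "fn \<Rightarrow> real" where
  "l2norm f = sqrt (integral\<^sup>L lborel (\<lambda>x. indicator {0..} x * (cmod (f x))\<^sup>2))"

definition ae_eq :: "fn \<Rightarrow> fn \<Rightarrow> bool" where
  "ae_eq f g \<longleftrightarrow> (AE x in lborel. x \<ge> 0 \<longrightarrow> f x = g x)"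

definition op_eq :: "op \<Rightarrow> op \<Rightarrow> bool" where
  "op_eq T U \<longleftrightarrow> (\<forall>f\<in>L2. ae_eq (T f) (U f))"

definition contraction_op :: "op \<Rightarrow> bool" where
  "contraction_op T \<longleftrightarrow>
     (\<forall>f\<in>L2. T f \<in> L2) \<and>
     (\<forall>f\<in>L2. \<forall>g\<in>L2. ae_eq f g \<longrightarrow> ae_eq (T f) (T g)) \<and>
     (\<forall>f\<in>L2. \<forall>g\<in>L2. \<forall>c::complex.
         ae_eq (T (\<lambda>x. f x + c * g x)) (\<lambda>x. T f x + c * T g x)) \<and>
     (\<forall>f\<in>L2. l2norm (T f) \<le> l2norm f)"

definition semigroup :: "(real \<Rightarrow> op) \<Rightarrow> bool" where
  "semigroup V \<longleftrightarrow>
     (\<forall>t\<ge>0. contraction_op (V t)) \<and>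
     op_eq (V 0) id \<and>
     (\<forall>s\<ge>0. \<forall>t\<ge>0. op_eq (V (s + t)) (V s \<circ> V t)) \<and>
     (\<forall>f\<in>L2. \<forall>t0\<ge>0.
        ((\<lambda>t. l2norm (\<lambda>x. V t f x - V t0 f x)) \<longlongrightarrow> 0) (at t0 within {0..}))"

definition shift :: "real \<Rightarrow> op" where
  "shift t f = (\<lambda>x. if x \<ge> t then f (x - t) else 0)"

text \<open>Ordered product V_{0,t} \<circ> ... \<circ> V_{n-1,t} (indices 0..n-1 stand for 1..n).\<close>
definition prod_ops :: "(nat \<Rightarrow> real \<Rightarrow> op) \<Rightarrow> nat \<Rightarrow> real \<Rightarrow> op" where
  "prod_ops V n t = foldr (\<lambda>j T. V j t \<circ> T) [0..<n] id"

definition factorization :: "(nat \<Rightarrow> real \<Rightarrow> op) \<Rightarrow> nat \<Rightarrow> bool" where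
  "factorization V n \<longleftrightarrow>
     (\<forall>j<n. semigroup (V j)) \<and>
     (\<forall>j<n. \<forall>k<n. \<forall>t\<ge>0. op_eq (V j t \<circ> V k t) (V k t \<circ> V j t)) \<and>
     (\<forall>t\<ge>0. op_eq (shift t) (prod_ops V n t))"

definition majorized :: "nat \<Rightarrow> (nat \<Rightarrow> real) \<Rightarrow> (nat \<Rightarrow> real) \<Rightarrow> bool" where
  "majorized n x y \<longleftrightarrow>
     (\<forall>k\<in>{1..n}. (\<Sum>j<k. x j) \<le> (\<Sum>j<k. y j)) \<and> (\<Sum>j<n. x j) = (\<Sum>j<n. y j)"

end

theory Submission
  imports Defs "HOL-Complex_Analysis.Complex_Analysis"
begin

text \<open>Each \<open>V\<^bsub>j,t\<^esub>\<close> commutes with a dense set of shifts, because \<open>V\<^bsub>j,u\<^esub>\<close> commutes with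
  \<open>S\<^bsub>u\<^esub> = V\<^bsub>1,u\<^esub> \<cdots> V\<^bsub>n,u\<^esub>\<close> and one may take \<open>u = t/q\<close>. Hence the Laplace transform turns
  \<open>V\<^bsub>j,t\<^esub>\<close> into multiplication by a function \<open>\<phi>\<^bsub>j,t\<^esub>\<close>, holomorphic on the right half-plane and
  bounded by \<open>1\<close>, with \<open>\<Prod>\<^sub>j \<phi>\<^bsub>j,t\<^esub>(z) = e\<^bsup>-tz\<^esup>\<close>. Therefore \<open>g = - log \<phi>\<^bsub>j,t\<^esub>\<close> exists and
  satisfies \<open>0 \<le> Re g \<le> t Re z\<close>. Such a function has a bounded derivative and imaginary boundary values,
  so it extends by reflection to an entire function of linear growth, which is affine:
  \<open>\<phi>\<^bsub>j,t\<^esub>(z) = e\<^bsup>i\<alpha>(t) - \<beta>(t)z\<^esup>\<close>. The semigroup law in \<open>t\<close> makes \<open>e\<^bsup>i\<alpha>(t)\<^esup> = e\<^bsup>iat\<^esup>\<close> and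
  \<open>\<beta>(t) = bt\<close>, and injectivity of the Laplace transform identifies \<open>V\<^bsub>j,t\<^esub>\<close>.\<close>

section \<open>Holomorphic functions on a half-plane\<close>

text \<open>A Schwarz-Pick estimate. The Cayley transform centred at \<open>F w\<close> turns
  \<open>F\<close> into a map \<open>h\<close> into the unit disc, and Cauchy's inequality on the
  disc of radius \<open>Im w / 2\<close> bounds \<open>deriv h w\<close>. As
  \<open>F w - cnj (F w)\<close> has modulus \<open>2 * Im (F w)\<close>, the growth bound on
  \<open>Im (F w)\<close> cancels the radius.\<close>

lemma norm_deriv_le_of_Im_pos:
  assumes hol: "F holomorphic_on {w. 0 < Im w}"
    and pos: "\<And>w. 0 < Im w \<Longrightarrow> 0 < Im (F w)"
    and le: "\<And>w. 0 < Im w \<Longrightarrow> Im (F w) \<le> T * Im w"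
    and w: "0 < Im w"
  shows "cmod (deriv F w) \<le> 4 * T"
proof -
  define h where "h = (\<lambda>v. (F v - F w) / (F v - cnj (F w)))"
  define r where "r = Im w / 2"
  have r: "0 < r" using w by (simp add: r_def)
  have sub: "cball w r \<subseteq> {v. 0 < Im v}"
  proof
    fix v assume "v \<in> cball w r"
    then have "\<bar>Im (w - v)\<bar> \<le> r"
      using abs_Im_le_cmod[of "w - v"] by (simp add: dist_norm)
    then have "Im w - Im v \<le> Im w / 2" using abs_le_D1 by (fastforce simp: r_def)
    then show "v \<in> {v. 0 < Im v}" using w by simp
  qed
  have nz: "F v - cnj (F w) \<noteq> 0" if "0 < Im v" for v
  proof
    assume "F v - cnj (F w) = 0"
    then have "Im (F v) = - Im (F w)" by (simp add: complex_eq_iff)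
    with pos[OF that] pos[OF w] show False by simp
  qed
  have holh: "h holomorphic_on {v. 0 < Im v}"
    unfolding h_def using nz by (intro holomorphic_intros hol) auto
  have h1: "cmod (h v) \<le> 1" if "0 < Im v" for v
  proof -
    \<comment> \<open>Numerator and denominator of \<open>h v\<close> have the same real part, so
      only the imaginary parts need comparing.\<close>
    have "(Im (F v) - Im (F w))\<^sup>2 \<le> (Im (F v) + Im (F w))\<^sup>2"
      using pos[OF that] pos[OF w] by (intro power2_le_iff_abs_le[THEN iffD2]) auto
    then have "cmod (F v - F w) \<le> cmod (F v - cnj (F w))"
      by (simp add: cmod_def)
    then show ?thesis using nz[OF that] by (simp add: h_def norm_divide divide_le_eq_1)
  qed
  have "norm ((deriv ^^ 1) h w) \<le> fact 1 * 1 / r ^ 1"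
  proof (rule Cauchy_inequality)
    show "h holomorphic_on ball w r"
      using holh sub ball_subset_cball by (meson holomorphic_on_subset subset_trans)
    show "continuous_on (cball w r) h"
      using holh sub by (meson holomorphic_on_imp_continuous_on holomorphic_on_subset)
    show "norm (h v) \<le> 1" if "norm (w - v) = r" for v
      using h1 sub that by (auto simp: dist_norm subset_iff)
  qed (use r in auto)
  then have dh: "cmod (deriv h w) \<le> 1 / r" by simp
  have "(F has_field_derivative deriv F w) (at w)"
    using hol w by (auto intro!: holomorphic_derivI[of _ "{v. 0 < Im v}"] simp: open_halfspace_Im_gt)
  then have "(h has_field_derivative deriv F w / (F w - cnj (F w))) (at w)"
    unfolding h_def using nz[OF w]
    by (auto intro!: derivative_eq_intros)
  then have "deriv h w = deriv F w / (F w - cnj (F w))" by (rule DERIV_imp_deriv)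
  moreover have "cmod (F w - cnj (F w)) = 2 * Im (F w)"
    using pos[OF w] by (simp add: complex_diff_cnj norm_mult)
  ultimately have "cmod (deriv F w) \<le> 2 * Im (F w) / r"
    using dh pos[OF w] r by (simp add: norm_divide field_simps)
  also have "\<dots> \<le> 2 * (T * Im w) / r"
    using le[OF w] r by (intro divide_right_mono mult_left_mono) auto
  also have "\<dots> = 4 * T" using w by (simp add: r_def)
  finally show ?thesis .
qed

text \<open>The bounded derivative makes \<open>F\<close> Lipschitz, hence extendable to the closed
  half-plane. The two bounds on \<open>Im (F w)\<close> force real boundary values, so Schwarz
  reflection yields an entire function of linear growth, which is affine by Liouville.\<close>

lemma upper_half_plane_affine:
  assumes hol: "F holomorphic_on {w. 0 < Im w}"
    and pos: "\<And>w. 0 < Im w \<Longrightarrow> 0 < Im (F w)"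
    and le: "\<And>w. 0 < Im w \<Longrightarrow> Im (F w) \<le> T * Im w"
  shows "\<exists>p q :: real. \<forall>w. 0 < Im w \<longrightarrow> F w = of_real p + of_real q * w"
proof -
  let ?U = "{w::complex. 0 < Im w}"
  have T: "0 \<le> T" using pos[of \<i>] le[of \<i>] by simp
  have clU: "closure ?U = {w. 0 \<le> Im w}"
  proof -
    have "?U = {w. inner \<i> w > 0}" "{w. 0 \<le> Im w} = {w. inner \<i> w \<ge> 0}"
      by (auto simp: inner_complex_def)
    then show ?thesis using closure_halfspace_gt[of \<i> 0] by simp
  qed
  have "(4 * T)-lipschitz_on ?U F"
  proof (rule lipschitz_onI)
    fix x y assume xy: "x \<in> ?U" "y \<in> ?U"
    have "norm (F x - F y) \<le> 4 * T * norm (x - y)"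
    proof (rule field_differentiable_bound[where S = ?U])
      show "convex ?U" by (rule convex_halfspace_Im_gt)
      show "(F has_field_derivative deriv F z) (at z within ?U)" if "z \<in> ?U" for z
        using holomorphic_derivI[OF hol _ that] open_halfspace_Im_gt by blast
      show "norm (deriv F z) \<le> 4 * T" if "z \<in> ?U" for z
        using norm_deriv_le_of_Im_pos[OF hol pos le] that by auto
    qed (use xy in auto)
    then show "dist (F x) (F y) \<le> 4 * T * dist x y" by (simp add: dist_norm)
  qed (use T in auto)
  then obtain G where G: "(4 * T)-lipschitz_on {w. 0 \<le> Im w} G" and GF: "\<And>w. 0 < Im w \<Longrightarrow> G w = F w"
    using lipschitz_extend_closure[of "4 * T" ?U F] clU by auto
  have contG: "continuous_on {w. 0 \<le> Im w} G" by (rule lipschitz_on_continuous_on[OF G])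
  have real: "G w \<in> \<real>" if "Im w = 0" for w
  proof -
    \<comment> \<open>The boundary point is approached vertically, and \<open>Im (G (u n))\<close>
      is squeezed between \<open>0\<close> and \<open>T / (n + 1)\<close>.\<close>
    define u where "u = (\<lambda>n. w + \<i> * of_real (inverse (real (Suc n))))"
    have "u \<longlonglongrightarrow> w + \<i> * of_real 0"
      unfolding u_def by (intro tendsto_intros LIMSEQ_inverse_real_of_nat)
    then have lim: "(\<lambda>n. G (u n)) \<longlonglongrightarrow> G w"
      using that by (intro continuous_on_tendsto_compose[OF contG]) (auto simp: u_def)
    have "(\<lambda>n. Im (G (u n))) \<longlonglongrightarrow> 0"
    proof (rule tendsto_sandwich)
      have Im_u: "Im (u n) = inverse (real (Suc n))" for n
      proof -
        have "Im (w + \<i> * of_real r) = r" for r using that by simp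
        then show ?thesis unfolding u_def .
      qed
      then have *: "0 < Im (u n)" for n by simp
      show "\<forall>\<^sub>F n in sequentially. 0 \<le> Im (G (u n))"
        using pos[OF *] GF[OF *] by (simp add: less_imp_le)
      show "\<forall>\<^sub>F n in sequentially. Im (G (u n)) \<le> T * inverse (real (Suc n))"
        using le[OF *] GF[OF *] by (simp only: Im_u) simp
      show "(\<lambda>n. T * inverse (real (Suc n))) \<longlonglongrightarrow> 0"
        using tendsto_mult_right_zero[OF LIMSEQ_inverse_real_of_nat] .
    qed auto
    with tendsto_Im[OF lim] have "Im (G w) = 0" using LIMSEQ_unique by blast
    then show ?thesis by (simp add: complex_is_Real_iff)
  qed
  \<comment> \<open>The Schwarz reflection of \<open>G\<close> across the real axis; the conjugation
    preserves moduli, so the growth bound for \<open>G\<close> carries over.\<close>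
  define E where "E = (\<lambda>z. if 0 \<le> Im z then G z else cnj (G (cnj z)))"
  have "E holomorphic_on UNIV"
    unfolding E_def
  proof (rule Schwarz_reflection)
    show "G holomorphic_on UNIV \<inter> ?U"
      using holomorphic_cong[of ?U ?U G F] GF hol by auto
  qed (use contG real in \<open>auto simp: complex_is_Real_iff\<close>)
  moreover have "norm (E z) \<le> (cmod (G 0) + 4 * T) * norm z ^ 1" if "1 \<le> norm z" for z
  proof -
    have *: "cmod (G v) \<le> (cmod (G 0) + 4 * T) * norm v" if "0 \<le> Im v" "1 \<le> norm v" for v
    proof -
      have "cmod (G v) \<le> cmod (G 0) + dist (G v) (G 0)"
        by (metis dist_norm norm_triangle_sub)
      also have "\<dots> \<le> cmod (G 0) + 4 * T * norm v"
        using lipschitz_onD[OF G, of v 0] that by simp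
      also have "\<dots> \<le> cmod (G 0) * norm v + 4 * T * norm v"
        using that by (simp add: mult_left_le mult_le_cancel_left1)
      finally show ?thesis by (simp add: algebra_simps)
    qed
    show ?thesis using *[of z] *[of "cnj z"] that by (auto simp: E_def)
  qed
  ultimately have Ez: "E z = E 0 + deriv E 0 * z" for z
    using Liouville_polynomial[of E 1 "cmod (G 0) + 4 * T" 1 z] by simp
  \<comment> \<open>\<open>E\<close> is real on the real axis, and its values at \<open>0\<close>
    and \<open>1\<close> determine both coefficients.\<close>
  have E0: "E 0 \<in> \<real>" using real[of 0] by (simp add: E_def)
  moreover have "E 1 \<in> \<real>" using real[of 1] by (simp add: E_def)
  ultimately have "deriv E 0 \<in> \<real>"
    using Ez[of 1] by (metis Reals_diff add_diff_cancel_left' mult.right_neutral)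
  with E0 obtain p q where "E 0 = of_real p" "deriv E 0 = of_real q"
    by (auto elim!: Reals_cases)
  then have "F w = of_real p + of_real q * w" if "0 < Im w" for w
    using Ez[of w] GF[OF that] that by (simp add: E_def)
  then show ?thesis by blast
qed

text \<open>The rotation \<open>z = - (\<i> * w)\<close> reduces this to the upper half-plane.
  Adding \<open>z\<close> to \<open>g z\<close> turns the weak bound \<open>0 \<le> Re (g z)\<close>
  into the strict positivity required there, at the price of replacing \<open>t\<close> by
  \<open>t + 1\<close>.\<close>

lemma right_half_plane_affine:
  assumes hol: "g holomorphic_on {z. 0 < Re z}"
    and nonneg: "\<And>z. 0 < Re z \<Longrightarrow> 0 \<le> Re (g z)"
    and le: "\<And>z. 0 < Re z \<Longrightarrow> Re (g z) \<le> t * Re z"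
  shows "\<exists>p q :: real. \<forall>z. 0 < Re z \<longrightarrow> g z = \<i> * of_real p + of_real q * z"
proof -
  define F where "F = (\<lambda>w. \<i> * (g (- (\<i> * w)) + (- (\<i> * w))))"
  have im: "Im (F w) = Re (g (- (\<i> * w))) + Im w" for w by (simp add: F_def)
  have "F holomorphic_on {w. 0 < Im w}"
    unfolding F_def
    by (intro holomorphic_intros holomorphic_on_compose_gen[OF _ hol, unfolded o_def]) auto
  moreover have "0 < Im (F w)" if "0 < Im w" for w
    using nonneg[of "- (\<i> * w)"] that by (simp add: im)
  moreover have "Im (F w) \<le> (t + 1) * Im w" if "0 < Im w" for w
    using le[of "- (\<i> * w)"] that by (simp add: im algebra_simps)
  ultimately obtain p q :: real where pq: "\<And>w. 0 < Im w \<Longrightarrow> F w = of_real p + of_real q * w"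
    using upper_half_plane_affine[of F "t + 1"] by auto
  have "g z = \<i> * of_real (- p) + of_real (q - 1) * z" if "0 < Re z" for z
  proof -
    have "- (\<i> * (\<i> * z)) = z" by (simp flip: mult.assoc)
    then have "\<i> * (g z + z) = of_real p + of_real q * (\<i> * z)"
      using pq[of "\<i> * z"] that by (simp add: F_def)
    also have "\<dots> = \<i> * (\<i> * of_real (- p) + of_real q * z)"
      by (simp add: complex_eq_iff algebra_simps)
    finally have "g z + z = \<i> * of_real (- p) + of_real q * z"
      by (simp only: mult_cancel_left) simp
    then show ?thesis by (simp add: algebra_simps)
  qed
  then show ?thesis by blast
qed

text \<open>Integrating the functional equation gives
  \<open>\<phi> t * I h = I (t + h) - I t\<close>. The right side is differentiable in
  \<open>t\<close>, so a continuous solution is automatically differentiable and satisfies a linear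
  differential equation.\<close>

lemma continuous_semigroup_hom_eq_exp:
  fixes \<phi> :: "real \<Rightarrow> complex"
  assumes cont: "continuous_on {0..} \<phi>" and zero: "\<phi> 0 = 1"
    and add: "\<And>s t. 0 \<le> s \<Longrightarrow> 0 \<le> t \<Longrightarrow> \<phi> (s + t) = \<phi> s * \<phi> t"
  shows "\<exists>c. \<forall>t\<ge>0. \<phi> t = exp (c * of_real t)"
proof -
  define I where "I = (\<lambda>x. integral {0..x} \<phi>)"
  have cont': "continuous_on {a..b} \<phi>" if "0 \<le> a" for a b
    using cont that by (elim continuous_on_subset) auto
  have dI: "(I has_vector_derivative \<phi> x) (at x within {0..b})" if "0 \<le> x" "x \<le> b" for x b
    unfolding I_def using that cont' by (intro integral_has_vector_derivative) auto
  \<comment> \<open>If \<open>I\<close> vanished for all positive arguments, its one-sided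
    derivative at \<open>0\<close>, which is \<open>\<phi> 0 = 1\<close>, would be
    \<open>0\<close>.\<close>
  obtain h where h: "0 < h" "I h \<noteq> 0"
  proof (rule ccontr)
    assume "\<not> thesis"
    then have "I x = 0" if "x \<in> {0..1}" for x
      using that \<open>\<And>h. 0 < h \<Longrightarrow> I h \<noteq> 0 \<Longrightarrow> thesis\<close> by (cases "x = 0") (force simp: I_def)+
    then have "((\<lambda>x. 0) has_vector_derivative \<phi> 0) (at 0 within {0..1})"
      using dI[of 0 1] by (auto intro: has_vector_derivative_transform[rotated 2])
    then have "\<phi> 0 = 0"
      by (intro vector_derivative_unique_within[OF _ _ has_vector_derivative_const])
         (auto simp: trivial_limit_within islimpt_Icc)
    with zero show False by simp
  qed
  have eq: "\<phi> t * I h = I (t + h) - I t" if "0 \<le> t" for t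
  proof -
    have "\<phi> t * I h = integral {0..h} (\<lambda>s. \<phi> t * \<phi> s)" by (simp add: I_def)
    also have "\<dots> = integral {0..h} (\<lambda>s. \<phi> (s + t))"
      using that add by (intro Henstock_Kurzweil_Integration.integral_cong) (auto simp: mult.commute)
    also have "\<dots> = integral {t..t + h} \<phi>"
      using integral_shift[of 0 t h \<phi>] cont'[of t "t + h"] that h
      by (simp add: o_def add.commute)
    also have "\<dots> = I (t + h) - I t"
      unfolding I_def
      using Henstock_Kurzweil_Integration.integral_combine[of 0 t "t + h" \<phi>] that h
        integrable_continuous_real[OF cont'[of 0 "t + h"]] by (simp add: algebra_simps)
    finally show ?thesis .
  qed
  define c where "c = (\<phi> h - 1) / I h"
  have d\<phi>: "(\<phi> has_vector_derivative c * \<phi> t) (at t within {0..b})" if "0 \<le> t" "t \<le> b" for t b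
  proof -
    have "((\<lambda>t. I (t + h)) has_vector_derivative \<phi> (t + h)) (at t within {0..b})"
    proof -
      have "(I has_vector_derivative \<phi> (t + h)) (at (t + h) within (\<lambda>t. t + h) ` {0..b})"
        using that h by (intro has_vector_derivative_within_subset[OF dI[of "t + h" "b + h"]]) auto
      moreover have "((\<lambda>t. t + h) has_vector_derivative 1) (at t within {0..b})"
        by (auto intro!: derivative_eq_intros)
      ultimately show ?thesis
        using vector_diff_chain_within[of "\<lambda>t. t + h" 1 t "{0..b}" I "\<phi> (t + h)"] by (simp add: o_def)
    qed
    then have "((\<lambda>t. (I (t + h) - I t) * inverse (I h)) has_vector_derivative
        (\<phi> (t + h) - \<phi> t) * inverse (I h)) (at t within {0..b})"
      using dI that by (intro has_vector_derivative_mult_left has_vector_derivative_diff) auto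
    moreover have "(\<phi> (t + h) - \<phi> t) * inverse (I h) = c * \<phi> t"
      using add[of t h] that h by (simp add: c_def field_simps)
    ultimately show ?thesis
      using eq h that
      by (auto elim!: has_vector_derivative_transform[rotated 2] simp: field_simps)
  qed
  have "\<phi> t = exp (c * of_real t)" if t: "0 \<le> t" for t
  proof -
    \<comment> \<open>The integrating factor makes the derivative vanish, so \<open>y\<close> keeps
      its initial value \<open>1\<close>.\<close>
    define y where "y = (\<lambda>s. \<phi> s * exp (- c * of_real s))"
    have "\<exists>k. \<forall>s\<in>{0..t}. y s = k"
    proof (rule has_vector_derivative_zero_constant)
      fix s assume s: "s \<in> {0..t}"
      have "((\<lambda>s. exp (- c * of_real s)) has_vector_derivative (- c * exp (- c * of_real s))) (at s within {0..t})"
        by (auto intro!: derivative_eq_intros has_vector_derivative_real_field)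
      then have "(y has_vector_derivative (\<phi> s * (- c * exp (- c * of_real s)) + c * \<phi> s * exp (- c * of_real s))) (at s within {0..t})"
        unfolding y_def using d\<phi>[of s t] s by (intro has_vector_derivative_mult) auto
      then show "(y has_vector_derivative 0) (at s within {0..t})" by (simp add: algebra_simps)
    qed auto
    then have "y t = y 0" using t by auto
    then show ?thesis using zero by (simp add: y_def exp_minus field_simps)
  qed
  then show ?thesis by blast
qed

section \<open>Square-integrable functions on the half-line\<close>

lemma L2_measurable [measurable_dest]: "f \<in> L2 \<Longrightarrow> f \<in> borel_measurable borel"
  by (simp add: L2_def)

lemma L2_integrable: "f \<in> L2 \<Longrightarrow> integrable lborel (\<lambda>x. indicator {0..} x * (cmod (f x))\<^sup>2)"
  by (simp add: L2_def)

lemma L2I: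
  assumes "f \<in> borel_measurable borel"
    and "integrable lborel (\<lambda>x. indicator {0..} x * (cmod (f x))\<^sup>2)"
  shows "f \<in> L2"
  using assms by (simp add: L2_def)

lemma l2norm_nonneg [simp]: "0 \<le> l2norm f"
  by (simp add: l2norm_def)

lemma l2norm_power2: "(l2norm f)\<^sup>2 = (LINT x|lborel. indicator {0..} x * (cmod (f x))\<^sup>2)"
  by (simp add: l2norm_def)

lemma L2_bound:
  assumes [measurable]: "f \<in> borel_measurable borel" and g: "g \<in> L2"
    and le: "\<And>x. 0 \<le> x \<Longrightarrow> cmod (f x) \<le> cmod (g x)"
  shows "f \<in> L2"
proof (rule L2I)
  show "integrable lborel (\<lambda>x. indicator {0..} x * (cmod (f x))\<^sup>2)"
    by (rule Bochner_Integration.integrable_bound[OF L2_integrable[OF g]])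
       (use le in \<open>auto simp: indicator_def power_mono\<close>)
qed fact

lemma l2norm_mono:
  assumes "f \<in> L2" and "g \<in> L2" and "\<And>x. 0 \<le> x \<Longrightarrow> cmod (f x) \<le> cmod (g x)"
  shows "l2norm f \<le> l2norm g"
  unfolding l2norm_def using assms L2_integrable
  by (auto intro!: real_sqrt_le_mono integral_mono simp: indicator_def power_mono)

lemma L2_add_scaled:
  assumes f: "f \<in> L2" and g: "g \<in> L2"
  shows "(\<lambda>x. f x + c * g x) \<in> L2"
proof (rule L2I)
  note [measurable] = L2_measurable[OF f] L2_measurable[OF g]
  show "(\<lambda>x. f x + c * g x) \<in> borel_measurable borel" by measurable
  let ?w = "\<lambda>x. 2 * (indicator {0..} x * (cmod (f x))\<^sup>2) + 2 * (cmod c)\<^sup>2 * (indicator {0..} x * (cmod (g x))\<^sup>2)"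
  have "(cmod (f x + c * g x))\<^sup>2 \<le> 2 * (cmod (f x))\<^sup>2 + 2 * (cmod c)\<^sup>2 * (cmod (g x))\<^sup>2" for x
  proof -
    have "(cmod (f x + c * g x))\<^sup>2 \<le> (cmod (f x) + cmod c * cmod (g x))\<^sup>2"
      using norm_triangle_ineq[of "f x" "c * g x"] by (intro power_mono) (simp_all add: norm_mult)
    also have "\<dots> \<le> 2 * (cmod (f x))\<^sup>2 + 2 * (cmod c * cmod (g x))\<^sup>2"
      using sum_squares_bound[of "cmod (f x)" "cmod c * cmod (g x)"]
      by (simp add: power2_sum)
    finally show ?thesis by (simp add: power_mult_distrib)
  qed
  then have le: "norm (indicator {0..} x * (cmod (f x + c * g x))\<^sup>2) \<le> norm (?w x)" for x
    by (cases "0 \<le> x") simp_all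
  have "integrable lborel ?w"
    using L2_integrable[OF f] L2_integrable[OF g] by simp
  then show "integrable lborel (\<lambda>x. indicator {0..} x * (cmod (f x + c * g x))\<^sup>2)"
    by (rule Bochner_Integration.integrable_bound) (use le in auto)
qed

lemma L2_zero: "(\<lambda>_. 0) \<in> L2"
  by (rule L2I) auto

lemma L2_scaled: "f \<in> L2 \<Longrightarrow> (\<lambda>x. c * f x) \<in> L2"
  using L2_add_scaled[OF L2_zero, of f c] by simp

lemma L2_diff: "f \<in> L2 \<Longrightarrow> g \<in> L2 \<Longrightarrow> (\<lambda>x. f x - g x) \<in> L2"
  using L2_add_scaled[of f g "-1"] by simp

lemma L2_sum: "(\<And>i. i \<in> I \<Longrightarrow> f i \<in> L2) \<Longrightarrow> (\<lambda>x. \<Sum>i\<in>I. f i x) \<in> L2"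
proof (induction I rule: infinite_finite_induct)
  case (insert i I)
  then show ?case using L2_add_scaled[of "f i" "\<lambda>x. \<Sum>i\<in>I. f i x" 1] by simp
qed (auto simp: L2_zero)

text \<open>The squared difference is dominated by four times the square of the majorant, so the
  scalar theorem applies to the squares.\<close>

lemma L2_dominated_convergence:
  assumes [measurable]: "\<And>n. F n \<in> borel_measurable borel" "f \<in> borel_measurable borel"
    and g: "g \<in> L2"
    and le: "\<And>n x. 0 \<le> x \<Longrightarrow> cmod (F n x) \<le> cmod (g x)"
    and lim: "\<And>x. 0 \<le> x \<Longrightarrow> (\<lambda>n. F n x) \<longlonglongrightarrow> f x"
  shows "(\<lambda>n. l2norm (\<lambda>x. F n x - f x)) \<longlonglongrightarrow> 0" and "f \<in> L2" and "F n \<in> L2"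
proof -
  note [measurable] = L2_measurable[OF g]
  have lef: "cmod (f x) \<le> cmod (g x)" if "0 \<le> x" for x
    by (rule LIMSEQ_le_const2[OF tendsto_norm[OF lim[OF that]]]) (use le that in auto)
  show "f \<in> L2" "F n \<in> L2" using g le lef by (auto intro: L2_bound)
  let ?w = "\<lambda>x. 4 * (indicator {0..} x * (cmod (g x))\<^sup>2)"
  have "(\<lambda>n. LINT x|lborel. indicator {0..} x * (cmod (F n x - f x))\<^sup>2) \<longlonglongrightarrow> integral\<^sup>L lborel (\<lambda>x::real. 0::real)"
  proof (rule integral_dominated_convergence[where w = ?w])
    show "integrable lborel ?w" using L2_integrable[OF g] by simp
    show "AE x in lborel. (\<lambda>n. indicator {0..} x * (cmod (F n x - f x))\<^sup>2) \<longlonglongrightarrow> 0"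
    proof (rule AE_I2)
      fix x :: real
      have "(\<lambda>n. (cmod (F n x - f x))\<^sup>2) \<longlonglongrightarrow> (cmod (f x - f x))\<^sup>2" if "0 \<le> x"
        using lim[OF that] by (intro tendsto_intros)
      then show "(\<lambda>n. indicator {0..} x * (cmod (F n x - f x))\<^sup>2) \<longlonglongrightarrow> 0"
        by (auto simp: indicator_def)
    qed
    show "AE x in lborel. norm (indicator {0..} x * (cmod (F n x - f x))\<^sup>2) \<le> ?w x" for n
    proof (rule AE_I2)
      fix x :: real
      have "(cmod (F n x - f x))\<^sup>2 \<le> (2 * cmod (g x))\<^sup>2" if "0 \<le> x"
        using norm_triangle_ineq4[of "F n x" "f x"] le[OF that, of n] lef[OF that]
        by (intro power_mono) auto
      then show "norm (indicator {0..} x * (cmod (F n x - f x))\<^sup>2) \<le> ?w x"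
        by (auto simp: indicator_def power_mult_distrib)
    qed
  qed measurable
  then show "(\<lambda>n. l2norm (\<lambda>x. F n x - f x)) \<longlonglongrightarrow> 0"
    unfolding l2norm_def using tendsto_real_sqrt by fastforce
qed

text \<open>Bilinear, without conjugation: this keeps it symmetric and makes the Laplace transform
  an instance that is holomorphic in its parameter.\<close>

definition pairing :: "fn \<Rightarrow> fn \<Rightarrow> complex" where
  "pairing f g = (LINT x:{0..}|lborel. f x * g x)"

lemma pairing_commute: "pairing f g = pairing g f"
  by (simp add: pairing_def mult.commute)

lemma pairing_integrable:
  assumes f: "f \<in> L2" and g: "g \<in> L2"
  shows "set_integrable lborel {0..} (\<lambda>x. f x * g x)"
    and "integrable lborel (\<lambda>x. indicator {0..} x * (cmod (f x) * cmod (g x)))"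
proof -
  note [measurable] = L2_measurable[OF f] L2_measurable[OF g]
  let ?w = "\<lambda>x. indicator {0..} x * (cmod (f x))\<^sup>2 + indicator {0..} x * (cmod (g x))\<^sup>2"
  have w: "integrable lborel ?w"
    using f g by (intro Bochner_Integration.integrable_add L2_integrable)
  have *: "cmod (f x) * cmod (g x) \<le> (cmod (f x))\<^sup>2 + (cmod (g x))\<^sup>2" for x
    using sum_squares_bound[of "cmod (f x)" "cmod (g x)"]
      mult_nonneg_nonneg[of "cmod (f x)" "cmod (g x)"] by (simp del: mult_nonneg_nonneg)
  show "set_integrable lborel {0..} (\<lambda>x. f x * g x)"
    unfolding set_integrable_def
    by (rule Bochner_Integration.integrable_bound[OF w])
       (use * in \<open>auto simp: indicator_def norm_mult\<close>)
  show "integrable lborel (\<lambda>x. indicator {0..} x * (cmod (f x) * cmod (g x)))"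
    by (rule Bochner_Integration.integrable_bound[OF w])
       (use * in \<open>auto simp: indicator_def norm_mult\<close>)
qed

lemma pairing_add_scaled:
  assumes "f \<in> L2" and "g \<in> L2" and "h \<in> L2"
  shows "pairing h (\<lambda>x. f x + c * g x) = pairing h f + c * pairing h g"
proof -
  have "pairing h (\<lambda>x. f x + c * g x) = (LINT x:{0..}|lborel. h x * f x + c * (h x * g x))"
    by (simp add: pairing_def algebra_simps)
  then show ?thesis
    using pairing_integrable(1)[of h f] pairing_integrable(1)[of h g] assms
    by (simp add: pairing_def set_integral_add set_integrable_mult_right)
qed

lemma pairing_zero [simp]: "pairing h (\<lambda>_. 0) = 0"
  by (simp add: pairing_def)

lemma pairing_scaled: "f \<in> L2 \<Longrightarrow> h \<in> L2 \<Longrightarrow> pairing h (\<lambda>x. c * f x) = c * pairing h f"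
  using pairing_add_scaled[OF L2_zero, of f h c] by simp

lemma pairing_diff:
  "f \<in> L2 \<Longrightarrow> g \<in> L2 \<Longrightarrow> h \<in> L2 \<Longrightarrow> pairing h (\<lambda>x. f x - g x) = pairing h f - pairing h g"
  using pairing_add_scaled[of f g h "-1"] by simp

lemma pairing_sum:
  "h \<in> L2 \<Longrightarrow> (\<And>i. i \<in> I \<Longrightarrow> f i \<in> L2) \<Longrightarrow> pairing h (\<lambda>x. \<Sum>i\<in>I. f i x) = (\<Sum>i\<in>I. pairing h (f i))"
proof (induction I rule: infinite_finite_induct)
  case (insert i I)
  then show ?case
    using pairing_add_scaled[of "f i" "\<lambda>x. \<Sum>i\<in>I. f i x" h 1] by (simp add: L2_sum)
qed auto

lemma pairing_cong:
  assumes "ae_eq f g" and "f \<in> L2" and "g \<in> L2" and "h \<in> L2"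
  shows "pairing h f = pairing h g"
proof -
  note [measurable] = assms(2-4)[THEN L2_measurable]
  show ?thesis unfolding pairing_def set_lebesgue_integral_def
    by (rule integral_cong_AE) (use assms(1) in \<open>auto simp: ae_eq_def indicator_def elim!: eventually_mono\<close>)
qed

lemma l2norm_cong:
  assumes "ae_eq f g" and "f \<in> L2" and "g \<in> L2"
  shows "l2norm f = l2norm g"
proof -
  note [measurable] = assms(2-3)[THEN L2_measurable]
  show ?thesis unfolding l2norm_def
    by (intro arg_cong[where f = sqrt] integral_cong_AE)
       (use assms(1) in \<open>auto simp: ae_eq_def indicator_def elim!: eventually_mono\<close>)
qed

lemma pairing_Cauchy_Schwarz:
  assumes f: "f \<in> L2" and g: "g \<in> L2"
  shows "cmod (pairing f g) \<le> l2norm f * l2norm g"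
proof -
  define P where "P = (LINT x|lborel. indicator {0..} x * (cmod (f x) * cmod (g x)))"
  define A where "A = (l2norm f)\<^sup>2"
  define B where "B = (l2norm g)\<^sup>2"
  have "cmod (pairing f g) \<le> (LINT x|lborel. norm (indicator {0..} x *\<^sub>R (f x * g x)))"
    unfolding pairing_def set_lebesgue_integral_def by (rule integral_norm_bound)
  also have "\<dots> = P" by (simp add: P_def norm_mult)
  finally have le: "cmod (pairing f g) \<le> P" .
  have P: "0 \<le> P" using le norm_ge_zero order_trans by blast
  \<comment> \<open>The integral of the square of \<open>a * cmod (f x) - cmod (g x)\<close>,
    expanded as a quadratic polynomial in \<open>a\<close>.\<close>
  have quad: "0 \<le> a\<^sup>2 * A - 2 * a * P + B" for a
  proof -
    have "0 \<le> (LINT x|lborel. indicator {0..} x * (a * cmod (f x) - cmod (g x))\<^sup>2)"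
      by (rule Bochner_Integration.integral_nonneg) simp
    also have "\<dots> = (LINT x|lborel. a\<^sup>2 * (indicator {0..} x * (cmod (f x))\<^sup>2)
        - 2 * a * (indicator {0..} x * (cmod (f x) * cmod (g x))) + indicator {0..} x * (cmod (g x))\<^sup>2)"
      by (rule Bochner_Integration.integral_cong) (auto simp: power2_eq_square algebra_simps)
    also have "\<dots> = a\<^sup>2 * A - 2 * a * P + B"
      using L2_integrable[OF f] L2_integrable[OF g] pairing_integrable(2)[OF f g]
      by (simp add: A_def B_def P_def l2norm_power2)
    finally show ?thesis .
  qed
  have "P\<^sup>2 \<le> A * B"
  proof (cases "A = 0")
    case True
    have "P = 0"
    proof (rule ccontr)
      assume "P \<noteq> 0"
      \<comment> \<open>With \<open>A = 0\<close> the polynomial is linear in \<open>a\<close>, and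
        this choice gives it the value \<open>-1\<close>.\<close>
      then show False using quad[of "(B + 1) / (2 * P)"] True by simp
    qed
    then show ?thesis using True by simp
  next
    case False
    then have "0 < A" by (simp add: A_def)
    \<comment> \<open>\<open>P / A\<close> is where the quadratic polynomial attains its
      minimum.\<close>
    then show ?thesis using quad[of "P / A"] by (simp add: power2_eq_square field_simps)
  qed
  then have "P\<^sup>2 \<le> (l2norm f * l2norm g)\<^sup>2" by (simp add: A_def B_def power_mult_distrib)
  then have "P \<le> l2norm f * l2norm g" by (rule power2_le_imp_le) simp
  with le show ?thesis by simp
qed

lemma pairing_tendsto:
  assumes F: "\<And>n. F n \<in> L2" and f: "f \<in> L2" and h: "h \<in> L2"
    and lim: "((\<lambda>n. l2norm (\<lambda>x. F n x - f x)) \<longlongrightarrow> 0) A"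
  shows "((\<lambda>n. pairing h (F n)) \<longlongrightarrow> pairing h f) A"
proof -
  have "((\<lambda>n. pairing h (F n) - pairing h f) \<longlongrightarrow> 0) A"
  proof (rule Lim_null_comparison)
    show "\<forall>\<^sub>F n in A. norm (pairing h (F n) - pairing h f) \<le> l2norm h * l2norm (\<lambda>x. F n x - f x)"
      using pairing_Cauchy_Schwarz[OF h L2_diff[OF F f]] pairing_diff[OF F f h] by simp
    show "((\<lambda>n. l2norm h * l2norm (\<lambda>x. F n x - f x)) \<longlongrightarrow> 0) A"
      using tendsto_mult_right_zero[OF lim] .
  qed
  then show ?thesis by (rule LIM_zero_cancel)
qed

section \<open>Interval indicators span a dense subspace\<close>

lemma L2_indicator_interval: "indicator {0..<s::real} \<in> L2"
proof (rule L2I)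
  have "(\<lambda>x. indicator {0..} x * (cmod (indicator {0..<s} x))\<^sup>2) = (indicator {0..<s} :: real \<Rightarrow> real)"
    by (auto simp: indicator_def fun_eq_iff)
  then show "integrable lborel (\<lambda>x. indicator {0..} x * (cmod (indicator {0..<s} x))\<^sup>2)"
    by (cases "0 \<le> s") auto
qed measurable

lemma L2_indicator_bounded:
  assumes "A \<in> sets borel"
  shows "indicator (A \<inter> {0..<s::real}) \<in> L2"
  by (rule L2_bound[OF _ L2_indicator_interval[of s]]) (use assms in \<open>auto simp: indicator_def\<close>)

text \<open>The induction form of density: identities that are linear and continuous need only be
  checked on indicators of \<open>{0..<s}\<close>. A Dynkin-system argument reaches bounded Borel
  sets, linear combinations reach truncated simple functions, and dominated convergence reaches all
  of \<open>L2\<close>.\<close>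

lemma L2_induct [consumes 1, case_names interval add_scaled limit]:
  fixes P :: "fn \<Rightarrow> bool"
  assumes f: "f \<in> L2"
    and interval: "\<And>s. 0 \<le> s \<Longrightarrow> P (indicator {0..<s})"
    and add_scaled: "\<And>f g c. f \<in> L2 \<Longrightarrow> P f \<Longrightarrow> g \<in> L2 \<Longrightarrow> P g \<Longrightarrow> P (\<lambda>x. f x + c * g x)"
    and limit: "\<And>F f. (\<And>n. F n \<in> L2) \<Longrightarrow> (\<And>n::nat. P (F n)) \<Longrightarrow> f \<in> L2 \<Longrightarrow>
      (\<lambda>n. l2norm (\<lambda>x. F n x - f x)) \<longlonglongrightarrow> 0 \<Longrightarrow> P f"
  shows "P f"
proof -
  have P0: "P (\<lambda>_. 0)"
  proof -
    have "(indicator {0..<0} :: fn) = (\<lambda>_. 0)" by (auto simp: indicator_def)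
    then show ?thesis using interval[of 0] by simp
  qed
  have Psum: "P (\<lambda>x. \<Sum>i\<in>I. c i * g i x)" if "\<And>i. i \<in> I \<Longrightarrow> g i \<in> L2 \<and> P (g i)" for I :: "'i set" and c g
    using that
  proof (induction I rule: infinite_finite_induct)
    case (insert i I)
    then have "P (\<lambda>x. (\<Sum>i\<in>I. c i * g i x) + c i * g i x)"
      by (intro add_scaled L2_sum L2_scaled) auto
    then show ?case using insert.hyps by (simp add: add.commute)
  qed (auto simp: P0)
  have Pset: "P (indicator (A \<inter> {0..<s}))" if "0 \<le> s" "A \<in> sets borel" for A s
  proof -
    have "Int_stable (range lessThan :: real set set)"
    proof -
      have "{..<a} \<inter> {..<b} = {..<min a b}" for a b :: real by auto
      then show ?thesis by (auto simp: Int_stable_def)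
    qed
    moreover have "range lessThan \<subseteq> Pow (UNIV :: real set)" by simp
    moreover have "A \<in> sigma_sets UNIV (range lessThan)"
      using that(2) by (simp add: borel_Iio)
    ultimately show ?thesis
    proof (induction rule: sigma_sets_induct_disjoint)
      case (basic A)
      then obtain a where "A = {..<a}" by auto
      \<comment> \<open>The clipping gives a nonnegative endpoint even when \<open>a\<close> is
        negative and the intersection is empty.\<close>
      then have "A \<inter> {0..<s} = {0..<max 0 (min a s)}" using that by auto
      then show ?case using interval[of "max 0 (min a s)"] by simp
    next
      case empty
      then show ?case using P0 by (simp add: indicator_def[abs_def])
    next
      case (compl A)
      then have A: "A \<in> sets borel" by (simp add: borel_Iio)
      have "(indicator ((UNIV - A) \<inter> {0..<s}) :: fn) = (\<lambda>x. indicator {0..<s} x + (-1) * indicator (A \<inter> {0..<s}) x)"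
        by (auto simp: indicator_def fun_eq_iff)
      then show ?case
        using add_scaled[OF L2_indicator_interval interval[OF that(1)] L2_indicator_bounded[OF A] compl(2), of "-1"]
        by simp
    next
      case (union A)
      then have A: "A i \<in> sets borel" for i by (auto simp: borel_Iio)
      \<comment> \<open>By disjointness the partial sums stay below the indicator of
        \<open>{0..<s}\<close>, which serves as majorant. The factor \<open>1 *\<close> fits the
        form of \<open>Psum\<close>.\<close>
      define F :: "nat \<Rightarrow> fn" where "F = (\<lambda>n x. \<Sum>i<n. 1 * indicator (A i \<inter> {0..<s}) x)"
      have F: "F n x = indicator ((\<Union>i<n. A i) \<inter> {0..<s}) x" for n x
      proof -
        have "(\<Sum>i<n. indicator (A i) x) = (indicator (\<Union>i<n. A i) x :: complex)"
          using union(1) by (subst indicator_UN_disjoint) (auto simp: disjoint_family_on_def)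
        then show ?thesis by (simp add: F_def indicator_inter_arith flip: sum_distrib_right)
      qed
      have lim: "(\<lambda>n. F n x) \<longlonglongrightarrow> indicator ((\<Union>i. A i) \<inter> {0..<s}) x" for x
      proof -
        have "(\<lambda>n. indicator (\<Union>i<n. A i) x :: complex) \<longlonglongrightarrow> indicator (\<Union>i. A i) x"
          by (rule LIMSEQ_indicator_UN)
        then show ?thesis unfolding F indicator_inter_arith by (intro tendsto_intros)
      qed
      have meas: "F n \<in> borel_measurable borel" for n
        using A by (simp add: F_def)
      have bd: "cmod (F n x) \<le> cmod (indicator {0..<s} x)" for n x
        by (auto simp: F indicator_def)
      have "(\<Union>i. A i) \<in> sets borel" using A by auto
      then have meas': "indicator ((\<Union>i. A i) \<inter> {0..<s}) \<in> borel_measurable borel" by auto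
      note dc = L2_dominated_convergence[OF meas meas' L2_indicator_interval bd lim]
      have "P (F n)" for n
        unfolding F_def using A union(3) L2_indicator_bounded by (intro Psum) auto
      then show ?case by (rule limit[OF dc(3) _ dc(2,1)])
    qed
  qed
  obtain S :: "nat \<Rightarrow> fn" where S: "\<And>i. simple_function borel (S i)" "\<And>x. (\<lambda>i. S i x) \<longlonglongrightarrow> f x"
    "\<And>i x. dist (S i x) 0 \<le> 2 * dist (f x) 0"
    using borel_measurable_implies_sequence_metric[OF L2_measurable[OF f], of 0] by auto
  \<comment> \<open>Truncation confines the level sets of the simple functions to a bounded
    interval, as \<open>Pset\<close> demands; it affects a given \<open>x\<close> for only finitely
    many \<open>i\<close>.\<close>
  define G where "G = (\<lambda>i x. S i x * indicator {0..<real i} x)"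
  note [measurable] = borel_measurable_simple_function[OF S(1)] L2_measurable[OF f]
  have G_P: "P (G i)" for i
  proof -
    have "G i = (\<lambda>x. \<Sum>y\<in>range (S i). y * indicator (S i -` {y} \<inter> {0..<real i}) x)"
    proof
      fix x
      have "finite (range (S i))" using S(1)[of i] by (simp add: simple_function_def)
      then have "(\<Sum>y\<in>range (S i). y * indicator (S i -` {y} \<inter> {0..<real i}) x)
          = (\<Sum>y\<in>{S i x}. y * indicator (S i -` {y} \<inter> {0..<real i}) x)"
        by (intro sum.mono_neutral_right) (auto simp: indicator_def)
      then show "G i x = (\<Sum>y\<in>range (S i). y * indicator (S i -` {y} \<inter> {0..<real i}) x)"
        by (simp add: G_def indicator_def)
    qed
    moreover have "S i -` {y} \<in> sets borel" for y
      using measurable_sets[of "S i" borel borel "{y}"] by simp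
    ultimately show ?thesis
      using Psum[of "range (S i)" "\<lambda>y. indicator (S i -` {y} \<inter> {0..<real i})" "\<lambda>y. y"]
        L2_indicator_bounded Pset by simp
  qed
  have G_meas: "G i \<in> borel_measurable borel" for i unfolding G_def by measurable
  have G_le: "cmod (G i x) \<le> cmod (2 * f x)" for i x
    using S(3)[of i x] by (auto simp: G_def indicator_def norm_mult)
  have G_lim: "(\<lambda>i. G i x) \<longlonglongrightarrow> f x" if "0 \<le> x" for x
  proof (rule Lim_transform_eventually[OF S(2)])
    have "\<forall>\<^sub>F i in sequentially. x < real i"
      using reals_Archimedean2 eventually_sequentially by (metis less_le_trans of_nat_le_iff)
    then show "\<forall>\<^sub>F i in sequentially. S i x = G i x"
      by eventually_elim (use that in \<open>simp add: G_def\<close>)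
  qed
  note dc = L2_dominated_convergence[OF G_meas L2_measurable[OF f] L2_scaled[OF f, of 2] G_le G_lim]
  show ?thesis by (rule limit[OF dc(3) G_P f dc(1)])
qed

section \<open>The Laplace transform\<close>

lemma L2_exp:
  assumes z: "0 < Re z"
  shows "(\<lambda>x. exp (- (z * of_real x))) \<in> L2"
proof (rule L2I)
  define r where "r = 2 * Re z"
  have r: "0 < r" using z by (simp add: r_def)
  have "(\<integral>\<^sup>+x. ennreal (exp (- (r * x))) * indicator {0..} x \<partial>lborel) = ennreal (0 - (- (exp (- (r * 0)) / r)))"
  proof (rule nn_integral_FTC_atLeast)
    show "((\<lambda>x. - (exp (- (r * x)) / r)) has_real_derivative exp (- (r * x))) (at x)" for x
      using r by (auto intro!: derivative_eq_intros)
    have "((\<lambda>x. exp (- (r * x))) \<longlongrightarrow> 0) at_top"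
      using r by (intro filterlim_compose[OF exp_at_bot] filterlim_compose[OF filterlim_uminus_at_bot_at_top]
          filterlim_tendsto_pos_mult_at_top[OF tendsto_const] filterlim_ident)
    then show "((\<lambda>x. - (exp (- (r * x)) / r)) \<longlongrightarrow> 0) at_top"
      using tendsto_minus[OF tendsto_divide_zero] by fastforce
  qed auto
  then have "(\<integral>\<^sup>+x. ennreal (indicator {0..} x * exp (- (r * x))) \<partial>lborel) < \<infinity>"
    by (simp add: mult.commute ennreal_mult' ennreal_indicator)
  then have "integrable lborel (\<lambda>x. indicator {0..} x * exp (- (r * x)))"
    by (intro integrableI_nonneg) auto
  moreover have "(cmod (exp (- (z * of_real x))))\<^sup>2 = exp (- (r * x))" for x
    by (simp add: r_def flip: exp_double)
  ultimately show "integrable lborel (\<lambda>x. indicator {0..} x * (cmod (exp (- (z * of_real x))))\<^sup>2)"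
    by simp
qed measurable

definition laplace :: "complex \<Rightarrow> fn \<Rightarrow> complex" where
  "laplace z f = pairing (\<lambda>x. exp (- (z * of_real x))) f"

lemma laplace_cong: "0 < Re z \<Longrightarrow> ae_eq f g \<Longrightarrow> f \<in> L2 \<Longrightarrow> g \<in> L2 \<Longrightarrow> laplace z f = laplace z g"
  unfolding laplace_def by (rule pairing_cong) (simp_all add: L2_exp)

lemma laplace_add_scaled:
  "0 < Re z \<Longrightarrow> f \<in> L2 \<Longrightarrow> g \<in> L2 \<Longrightarrow> laplace z (\<lambda>x. f x + c * g x) = laplace z f + c * laplace z g"
  by (simp add: laplace_def pairing_add_scaled L2_exp)

lemma laplace_scaled: "0 < Re z \<Longrightarrow> f \<in> L2 \<Longrightarrow> laplace z (\<lambda>x. c * f x) = c * laplace z f"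
  by (simp add: laplace_def pairing_scaled L2_exp)

lemma laplace_diff:
  "0 < Re z \<Longrightarrow> f \<in> L2 \<Longrightarrow> g \<in> L2 \<Longrightarrow> laplace z (\<lambda>x. f x - g x) = laplace z f - laplace z g"
  by (simp add: laplace_def pairing_diff L2_exp)

lemma norm_laplace_le:
  "0 < Re z \<Longrightarrow> f \<in> L2 \<Longrightarrow> cmod (laplace z f) \<le> l2norm (\<lambda>x. exp (- (z * of_real x))) * l2norm f"
  by (simp add: laplace_def pairing_Cauchy_Schwarz L2_exp)

lemma laplace_tendsto:
  assumes "\<And>n. F n \<in> L2" and "f \<in> L2" and "0 < Re z"
    and "((\<lambda>n. l2norm (\<lambda>x. F n x - f x)) \<longlongrightarrow> 0) A"
  shows "((\<lambda>n. laplace z (F n)) \<longlongrightarrow> laplace z f) A"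
  unfolding laplace_def using assms by (intro pairing_tendsto L2_exp)

lemma laplace_indicator:
  assumes z: "0 < Re z" and s: "0 \<le> s"
  shows "laplace z (indicator {0..<s}) = (1 - exp (- (z * of_real s))) / z"
proof -
  have z0: "z \<noteq> 0" using z by auto
  have "laplace z (indicator {0..<s}) = (LINT x|lborel. indicator {0..s} x *\<^sub>R exp (- (z * of_real x)))"
    unfolding laplace_def pairing_def set_lebesgue_integral_def
  proof (rule integral_cong_AE)
    have "AE x in lborel. x \<noteq> s" by (rule AE_lborel_singleton)
    then show "AE x in lborel. indicator {0..} x *\<^sub>R (exp (- (z * of_real x)) * indicator {0..<s} x)
        = indicator {0..s} x *\<^sub>R exp (- (z * complex_of_real x))"
      by eventually_elim (auto simp: indicator_def)
  qed measurable
  also have "\<dots> = - (exp (- (z * of_real s)) / z) - - (exp (- (z * of_real 0)) / z)"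
  proof (rule integral_FTC_Icc)
    show "((\<lambda>x. - (exp (- (z * of_real x)) / z)) has_vector_derivative exp (- (z * of_real x))) (at x within {0..s})" for x
      using z0 by (auto intro!: derivative_eq_intros has_vector_derivative_real_field)
    show "continuous_on {0..s} (\<lambda>x. exp (- (z * complex_of_real x)))"
      by (intro continuous_intros)
  qed (use s in auto)
  also have "\<dots> = (1 - exp (- (z * of_real s))) / z"
    by (simp add: diff_divide_distrib)
  finally show ?thesis .
qed

lemma shift_L2:
  assumes f: "f \<in> L2" and s: "0 \<le> s"
  shows "shift s f \<in> L2"
proof (rule L2I)
  note [measurable] = L2_measurable[OF f]
  show "shift s f \<in> borel_measurable borel"
    unfolding shift_def by measurable
  have "integrable lborel (\<lambda>x. indicator {0..} (- s + 1 * x) * (cmod (f (- s + 1 * x)))\<^sup>2)"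
    by (rule lborel_integrable_real_affine[OF L2_integrable[OF f]]) simp
  moreover have "indicator {0..} (- s + 1 * x) * (cmod (f (- s + 1 * x)))\<^sup>2
      = indicator {0..} x * (cmod (shift s f x))\<^sup>2" for x
    using s by (auto simp: shift_def indicator_def)
  ultimately show "integrable lborel (\<lambda>x. indicator {0..} x * (cmod (shift s f x))\<^sup>2)" by simp
qed

text \<open>Substituting \<open>s + x\<close> for \<open>x\<close> moves the shifted function back
  to the half-line and splits off the exponential, so shifts become multiplications.\<close>

lemma laplace_shift:
  assumes s: "0 \<le> s"
  shows "laplace z (shift s f) = exp (- (z * of_real s)) * laplace z f"
proof -
  define h where "h = (\<lambda>x. indicator {0..} x *\<^sub>R (exp (- (z * of_real x)) * shift s f x))"
  have "laplace z (shift s f) = (LINT x|lborel. h x)"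
    by (simp add: laplace_def pairing_def h_def set_lebesgue_integral_def)
  also have "\<dots> = (LINT x|lborel. h (s + x))"
    using lborel_integral_real_affine[of 1 h s] by simp
  also have "\<dots> = (LINT x|lborel. exp (- (z * of_real s)) * (indicator {0..} x *\<^sub>R (exp (- (z * of_real x)) * f x)))"
    by (rule Bochner_Integration.integral_cong)
       (use s in \<open>auto simp: h_def shift_def indicator_def algebra_simps exp_add exp_diff exp_minus field_simps\<close>)
  also have "\<dots> = exp (- (z * of_real s)) * laplace z f"
    unfolding laplace_def pairing_def set_lebesgue_integral_def by (rule integral_mult_right_zero)
  finally show ?thesis .
qed

text \<open>Explicit for interval indicators and preserved by linear combinations. By
  Cauchy-Schwarz, convergence in norm gives locally uniform convergence of the transforms, which
  preserves holomorphy.\<close>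

lemma laplace_holomorphic:
  assumes "f \<in> L2"
  shows "(\<lambda>z. laplace z f) holomorphic_on {z. 0 < Re z}"
  using assms
proof (induction rule: L2_induct)
  case (interval s)
  have "(\<lambda>z. (1 - exp (- (z * of_real s))) / z) holomorphic_on {z. 0 < Re z}"
    by (intro holomorphic_intros) auto
  then show ?case
    by (rule holomorphic_transform) (simp add: laplace_indicator interval)
next
  case (add_scaled f g c)
  then have "(\<lambda>z. laplace z f + c * laplace z g) holomorphic_on {z. 0 < Re z}"
    by (intro holomorphic_intros)
  then show ?case
    by (rule holomorphic_transform) (simp add: laplace_add_scaled add_scaled)
next
  case (limit F f)
  show ?case
  proof (rule holomorphic_uniform_sequence)
    show "open {z. 0 < Re z}" by (rule open_halfspace_Re_gt)
    show "(\<lambda>z. laplace z (F n)) holomorphic_on {z. 0 < Re z}" for n by (rule limit)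
    fix w assume "w \<in> {z. 0 < Re z}"
    then have w: "0 < Re w / 2" by simp
    \<comment> \<open>On the ball of radius \<open>Re w / 2\<close> about \<open>w\<close> every
      kernel is dominated in modulus by this one, which makes the estimate uniform in
      \<open>z\<close>.\<close>
    let ?e = "\<lambda>x. exp (- (of_real (Re w / 2) * complex_of_real x))"
    have Re_ge: "Re w / 2 \<le> Re z" if "z \<in> cball w (Re w / 2)" for z
      using that complex_Re_le_cmod[of "w - z"] by (simp add: dist_norm)
    have "uniform_limit (cball w (Re w / 2)) (\<lambda>n z. laplace z (F n)) (\<lambda>z. laplace z f) sequentially"
    proof (rule uniform_limitI)
      fix e :: real assume "0 < e"
      have "(\<lambda>n. l2norm ?e * l2norm (\<lambda>x. F n x - f x)) \<longlonglongrightarrow> 0"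
        using tendsto_mult_right_zero[OF limit(3)] .
      then have "\<forall>\<^sub>F n in sequentially. l2norm ?e * l2norm (\<lambda>x. F n x - f x) < e"
        using \<open>0 < e\<close> by (rule order_tendstoD)
      then show "\<forall>\<^sub>F n in sequentially. \<forall>z\<in>cball w (Re w / 2). dist (laplace z (F n)) (laplace z f) < e"
      proof eventually_elim
        case (elim n)
        show ?case
        proof
          fix z assume z: "z \<in> cball w (Re w / 2)"
          then have pos: "0 < Re z" using Re_ge w by fastforce
          have "dist (laplace z (F n)) (laplace z f) = cmod (laplace z (\<lambda>x. F n x - f x))"
            using laplace_diff[OF pos limit(1,2)] by (simp add: dist_norm)
          also have "\<dots> \<le> l2norm (\<lambda>x. exp (- (z * of_real x))) * l2norm (\<lambda>x. F n x - f x)"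
            by (intro norm_laplace_le pos L2_diff limit)
          also have "\<dots> \<le> l2norm ?e * l2norm (\<lambda>x. F n x - f x)"
            using w pos mult_right_mono[OF Re_ge[OF z]]
            by (intro mult_right_mono l2norm_mono L2_exp) auto
          finally show "dist (laplace z (F n)) (laplace z f) < e" using elim by simp
        qed
      qed
    qed
    moreover have "cball w (Re w / 2) \<subseteq> {z. 0 < Re z}"
      using Re_ge w by force
    ultimately show "\<exists>d>0. cball w d \<subseteq> {z. 0 < Re z} \<and>
        uniform_limit (cball w d) (\<lambda>n z. laplace z (F n)) (\<lambda>z. laplace z f) sequentially"
      using w by blast
  qed
qed

text \<open>The functions \<open>1 - exp (- e\<^bsup>k(s - x)\<^esup>)\<close> are \<open>L\<^sup>2\<close>-limits of linear combinations of
  exponentials \<open>e\<^bsup>-mkx\<^esup>\<close> and converge to the indicator of \<open>[0, s)\<close> as \<open>k\<close> grows.\<close>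

lemma laplace_inj:
  assumes g: "g \<in> L2" and zero: "\<And>z. 0 < Re z \<Longrightarrow> laplace z g = 0"
  shows "ae_eq g (\<lambda>_. 0)"
proof -
  have exp_zero: "pairing g (\<lambda>x. exp (- (z * of_real x))) = 0" if "0 < Re z" for z
    using zero[OF that] by (simp add: laplace_def pairing_commute)
  have doubly_exp: "pairing g (\<lambda>x. 1 - exp (- of_real (exp (k * (s - x))))) = 0"
    if k: "0 < k" for k s :: real
  proof -
    \<comment> \<open>Negated partial sums of the exponential series at
      \<open>- exp (k * (s - x))\<close>, without the constant term. What remains are multiples of
      decaying exponentials, all of which lie in \<open>L2\<close> and pair to zero with
      \<open>g\<close>.\<close>
    define F :: "nat \<Rightarrow> fn" where
      "F = (\<lambda>n x. - (\<Sum>m<n. (- of_real (exp (k * (s - x)))) ^ Suc m / fact (Suc m)))"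
    define H :: fn where "H = (\<lambda>x. 1 - exp (- of_real (exp (k * (s - x)))))"
    \<comment> \<open>With \<open>r = exp (k * (s - x))\<close> the partial sums are bounded by
      \<open>r * exp r\<close>: the factor \<open>r\<close> supplies the decay in \<open>x\<close>,
      and \<open>exp r\<close> is at most \<open>exp (exp (k * s))\<close> for nonnegative
      \<open>x\<close>.\<close>
    define c where "c = exp (k * s) * exp (exp (k * s))"
    have F_exp: "F n = (\<lambda>x. \<Sum>m<n. - ((- of_real (exp (k * s))) ^ Suc m / fact (Suc m)) *
        exp (- (of_real (real (Suc m) * k) * of_real x)))" for n
    proof
      fix x
      have "(- of_real (exp (k * (s - x)))) ^ Suc m =
          (- of_real (exp (k * s))) ^ Suc m * exp (- (of_real (real (Suc m) * k) * of_real x) :: complex)" for m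
      proof -
        have "exp (k * (s - x)) = exp (k * s) * exp (- (k * x))"
          by (simp add: algebra_simps flip: exp_add)
        moreover have "exp (- (k * x)) ^ Suc m = exp (- (real (Suc m) * k * x))"
          by (simp only: exp_of_nat_mult[symmetric]) (simp add: algebra_simps)
        then have "complex_of_real (exp (- (k * x))) ^ Suc m = exp (- (of_real (real (Suc m) * k) * of_real x))"
          by (metis exp_of_real of_real_minus of_real_mult of_real_power)
        ultimately show ?thesis
          by (metis mult_minus_left of_real_mult power_mult_distrib)
      qed
      then show "F n x = (\<Sum>m<n. - ((- of_real (exp (k * s))) ^ Suc m / fact (Suc m)) *
        exp (- (of_real (real (Suc m) * k) * of_real x)))"
        unfolding F_def by (simp only: sum_negf[symmetric]) (simp add: algebra_simps)
    qed
    have pos: "0 < Re (of_real (real (Suc m) * k))" for m using k by simp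
    have "pairing g (F n) = 0" for n
    proof -
      have L: "(\<lambda>x. a * exp (- (of_real (real (Suc m) * k) * of_real x))) \<in> L2" for a :: complex and m
        by (rule L2_scaled[OF L2_exp[OF pos]])
      have Z: "pairing g (\<lambda>x. a * exp (- (of_real (real (Suc m) * k) * of_real x))) = 0" for a :: complex and m
        unfolding pairing_scaled[OF L2_exp[OF pos] g] exp_zero[OF pos] by simp
      show ?thesis
        unfolding F_exp by (subst pairing_sum[OF g]) (rule L | simp only: Z sum.neutral_const)+
    qed
    moreover have "(\<lambda>n. pairing g (F n)) \<longlonglongrightarrow> pairing g H"
    proof -
      have F_meas: "F n \<in> borel_measurable borel" for n unfolding F_def by measurable
      have H_meas: "H \<in> borel_measurable borel" unfolding H_def by measurable
      have bound_L2: "(\<lambda>x. of_real c * exp (- (of_real k * of_real x))) \<in> L2"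
        using k by (intro L2_scaled L2_exp) simp
      have F_lim: "(\<lambda>n. F n x) \<longlonglongrightarrow> H x" for x
      proof -
        define y where "y = - complex_of_real (exp (k * (s - x)))"
        have "(\<lambda>m. y ^ m / fact m) sums exp y"
          using exp_converges[of y] by (simp add: scaleR_conv_of_real divide_inverse mult.commute)
        then have "(\<lambda>m. y ^ Suc m / fact (Suc m)) sums (exp y - 1)"
          by (subst sums_Suc_iff) simp
        then have "(\<lambda>n. - (\<Sum>m<n. y ^ Suc m / fact (Suc m))) \<longlonglongrightarrow> - (exp y - 1)"
          unfolding sums_def by (rule tendsto_minus)
        then show ?thesis by (simp add: F_def H_def y_def)
      qed
      have F_le: "cmod (F n x) \<le> cmod (of_real c * exp (- (of_real k * of_real x)))" if "0 \<le> x" for n x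
      proof -
        define r where "r = exp (k * (s - x))"
        have r: "0 < r" by (simp add: r_def)
        have "cmod (F n x) \<le> (\<Sum>m<n. cmod ((- of_real r) ^ Suc m / fact (Suc m)))"
          unfolding F_def r_def norm_minus_cancel by (rule norm_sum)
        also have "\<dots> \<le> (\<Sum>m<n. r * (r ^ m / fact m))"
        proof (rule sum_mono)
          fix m
          have "r * r ^ m / fact (Suc m) \<le> r * r ^ m / fact m"
            using r by (intro divide_left_mono fact_mono) auto
          then show "cmod ((- of_real r) ^ Suc m / fact (Suc m)) \<le> r * (r ^ m / fact m)"
            using r by (simp add: norm_divide norm_mult norm_power del: fact_Suc)
        qed
        also have "\<dots> = r * (\<Sum>m<n. r ^ m / fact m)" by (simp add: sum_distrib_left)
        also have "\<dots> \<le> r * exp r"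
        proof -
          have "(\<lambda>m. r ^ m / fact m) sums exp r"
            using exp_converges[of r] by (simp add: divide_inverse mult.commute)
          then have "(\<Sum>m<n. r ^ m / fact m) \<le> exp r"
            using r sum_le_suminf[of "\<lambda>m. r ^ m / fact m" "{..<n}"] by (simp add: sums_iff)
          then show ?thesis using r by simp
        qed
        also have "\<dots> \<le> (exp (k * s) * exp (- (k * x))) * exp (exp (k * s))"
        proof -
          have "r = exp (k * s) * exp (- (k * x))"
            by (simp add: r_def algebra_simps flip: exp_add)
          moreover have "r \<le> exp (k * s)" using k that by (simp add: r_def)
          ultimately show ?thesis by simp
        qed
        also have "\<dots> = cmod (of_real c * exp (- (of_real k * of_real x)))"
          by (simp add: c_def norm_mult)
        finally show ?thesis .
      qed
      note dc = L2_dominated_convergence[OF F_meas H_meas bound_L2 F_le F_lim]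
      show ?thesis by (rule pairing_tendsto[OF dc(3,2) g dc(1)])
    qed
    ultimately show ?thesis unfolding H_def by (simp add: LIMSEQ_const_iff)
  qed
  have indicator_zero: "pairing g (indicator {0..<s}) = 0" if s: "0 \<le> s" for s
  proof -
    \<comment> \<open>Taking \<open>Suc n\<close> keeps the rate at least \<open>1\<close>, so that
      \<open>exp (s - x)\<close> is a majorant for all \<open>n\<close> at once.\<close>
    define F :: "nat \<Rightarrow> fn" where "F = (\<lambda>n x. 1 - exp (- of_real (exp (real (Suc n) * (s - x)))))"
    \<comment> \<open>At \<open>x = s\<close> the functions have the constant value
      \<open>1 - exp (- 1)\<close>; this single point separates the limit from the
      indicator.\<close>
    define H :: fn where "H = (\<lambda>x. if x < s then 1 else if x = s then 1 - exp (- 1) else 0)"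
    have F_meas: "F n \<in> borel_measurable borel" for n unfolding F_def by measurable
    have H_meas: "H \<in> borel_measurable borel" unfolding H_def by measurable
    have bound_L2: "(\<lambda>x. of_real (exp s) * exp (- (1 * complex_of_real x))) \<in> L2"
      by (intro L2_scaled L2_exp) simp
    have F_real: "F n x = of_real (1 - exp (- exp (real (Suc n) * (s - x))))" for n x
      by (simp add: F_def flip: exp_of_real)
    have F_le: "cmod (F n x) \<le> cmod (of_real (exp s) * exp (- (1 * complex_of_real x)))" for n x
    proof -
      define u where "u = exp (real (Suc n) * (s - x))"
      have u: "0 < u" by (simp add: u_def)
      have "cmod (F n x) = cmod (of_real (1 - exp (- u)))"
        by (simp only: F_real u_def)
      also have "\<dots> = 1 - exp (- u)" using u by (simp only: norm_of_real) simp
      also have "\<dots> \<le> exp (s - x)"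
      proof (cases "s \<le> x")
        case True
        have "1 - exp (- u) \<le> u" using exp_ge_add_one_self[of "- u"] by simp
        also have "u \<le> exp (s - x)"
          using True mult_nonneg_nonpos[of "real n" "s - x"] by (simp add: u_def algebra_simps)
        finally show ?thesis .
      next
        case False
        then have "1 \<le> exp (s - x)" by simp
        then show ?thesis by (smt (verit) exp_gt_zero)
      qed
      also have "\<dots> = cmod (of_real (exp s) * exp (- (1 * complex_of_real x)))"
        by (simp add: norm_mult flip: exp_add)
      finally show ?thesis .
    qed
    have F_lim: "(\<lambda>n. F n x) \<longlonglongrightarrow> H x" for x
    proof -
      have "(\<lambda>n. 1 - exp (- exp (real (Suc n) * (s - x)))) \<longlonglongrightarrow> Re (H x)"
      proof (cases "s - x" "0 :: real" rule: linorder_cases)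
        case less
        then have "filterlim (\<lambda>n. (s - x) * real (Suc n)) at_bot sequentially"
          by (intro filterlim_tendsto_neg_mult_at_bot[OF tendsto_const] filterlim_compose[OF filterlim_real_sequentially filterlim_Suc])
        then have "(\<lambda>n. 1 - exp (- exp ((s - x) * real (Suc n)))) \<longlonglongrightarrow> 1 - exp (- 0)"
          by (intro tendsto_intros filterlim_compose[OF exp_at_bot])
        then have "(\<lambda>n. 1 - exp (- exp (real (Suc n) * (s - x)))) \<longlonglongrightarrow> 1 - exp (- 0)"
          by (simp only: mult.commute)
        then show ?thesis using less by (simp add: H_def)
      next
        case equal
        then show ?thesis by (simp add: H_def Re_exp)
      next
        case greater
        then have "filterlim (\<lambda>n. (s - x) * real (Suc n)) at_top sequentially"
          by (intro filterlim_tendsto_pos_mult_at_top[OF tendsto_const] filterlim_compose[OF filterlim_real_sequentially filterlim_Suc])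
        then have "(\<lambda>n. 1 - exp (- exp ((s - x) * real (Suc n)))) \<longlonglongrightarrow> 1 - 0"
          by (intro tendsto_intros filterlim_compose[OF exp_at_bot]
              filterlim_compose[OF filterlim_uminus_at_bot_at_top] filterlim_compose[OF exp_at_top])
        then have "(\<lambda>n. 1 - exp (- exp (real (Suc n) * (s - x)))) \<longlonglongrightarrow> 1 - 0"
          by (simp only: mult.commute)
        then show ?thesis using greater by (simp add: H_def)
      qed
      then have "(\<lambda>n. complex_of_real (1 - exp (- exp (real (Suc n) * (s - x))))) \<longlonglongrightarrow> of_real (Re (H x))"
        by (rule tendsto_of_real)
      moreover have "of_real (Re (H x)) = H x"
        by (simp add: H_def complex_eq_iff Im_exp)
      ultimately show ?thesis by (simp only: F_real)
    qed
    note dc = L2_dominated_convergence[OF F_meas H_meas bound_L2 F_le F_lim]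
    have "(\<lambda>n. pairing g (F n)) \<longlonglongrightarrow> pairing g H"
      by (rule pairing_tendsto[OF dc(3,2) g dc(1)])
    moreover have "pairing g (F n) = 0" for n
      unfolding F_def by (rule doubly_exp) simp
    ultimately have "pairing g H = 0" by (simp add: LIMSEQ_const_iff)
    moreover have "ae_eq H (indicator {0..<s})"
      using AE_lborel_singleton[of s] unfolding ae_eq_def
      by eventually_elim (auto simp: H_def indicator_def)
    ultimately show ?thesis
      using pairing_cong[OF _ dc(2) L2_indicator_interval g] by simp
  qed
  have all_zero: "pairing g h = 0" if "h \<in> L2" for h
    using that
  proof (induction rule: L2_induct)
    case (limit F f)
    then have "(\<lambda>n. pairing g (F n)) \<longlonglongrightarrow> pairing g f" by (intro pairing_tendsto g)
    then show ?case using limit(4) by (simp add: LIMSEQ_const_iff)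
  qed (simp_all add: indicator_zero pairing_add_scaled g)
  note [measurable] = L2_measurable[OF g]
  have [measurable]: "cnj \<in> borel_measurable borel"
    by (intro borel_measurable_continuous_onI continuous_intros)
  \<comment> \<open>Since the pairing has no conjugation, testing against \<open>cnj (g x)\<close>
    produces the squared norm of \<open>g\<close>.\<close>
  have "(\<lambda>x. cnj (g x)) \<in> L2"
    by (rule L2_bound[OF _ g]) auto
  then have "0 = pairing g (\<lambda>x. cnj (g x))" by (simp add: all_zero)
  also have "\<dots> = (LINT x|lborel. of_real (indicator {0..} x * (cmod (g x))\<^sup>2))"
    unfolding pairing_def set_lebesgue_integral_def
    by (rule Bochner_Integration.integral_cong) (auto simp: complex_norm_square indicator_def simp del: of_real_power)
  also have "\<dots> = of_real (LINT x|lborel. indicator {0..} x * (cmod (g x))\<^sup>2)"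
    by (rule integral_complex_of_real)
  finally have "(LINT x|lborel. indicator {0..} x * (cmod (g x))\<^sup>2) = 0" by simp
  then have "AE x in lborel. indicator {0..} x * (cmod (g x))\<^sup>2 = 0"
    using integral_nonneg_eq_0_iff_AE[OF L2_integrable[OF g]] by simp
  then show ?thesis unfolding ae_eq_def by eventually_elim (auto simp: indicator_def)
qed

section \<open>Symbols of contractions commuting with shifts\<close>

text \<open>Moduli at time \<open>1\<close> determine \<open>b\<close>. A single time would fix
  \<open>a\<close> only modulo \<open>2 * pi\<close>, which is why the hypothesis ranges over all
  nonnegative \<open>t\<close>.\<close>

lemma exp_linear_unique:
  fixes a b a' b' :: real
  assumes "\<And>t. 0 \<le> t \<Longrightarrow> exp (\<i> * of_real (a * t)) * exp (- of_real (b * t))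
    = (exp (\<i> * of_real (a' * t)) * exp (- of_real (b' * t)) :: complex)"
  shows "a = a'" and "b = b'"
proof -
  have "exp (- b) = exp (- b')"
    using arg_cong[where f = cmod, OF assms[of 1]] by (simp add: norm_mult)
  then show "b = b'" by simp
  then have eq: "exp (\<i> * of_real (a * t)) = exp (\<i> * of_real (a' * t))" if "0 \<le> t" for t
    using assms[OF that] by simp
  show "a = a'"
  proof (rule ccontr)
    assume ne: "a \<noteq> a'"
    \<comment> \<open>At this time the two phases differ by exactly \<open>pi\<close>, so their
      quotient would be \<open>-1\<close> instead of \<open>1\<close>.\<close>
    define t where "t = pi / \<bar>a - a'\<bar>"
    have "exp (\<i> * of_real ((a - a') * t)) = exp (\<i> * of_real (a * t)) / exp (\<i> * of_real (a' * t))"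
      by (simp add: algebra_simps flip: exp_diff)
    also have "\<dots> = 1" using eq[of t] ne by (simp add: t_def)
    finally have "Re (exp (\<i> * of_real ((a - a') * t))) = 1" by simp
    then have "cos \<bar>(a - a') * t\<bar> = 1" by (simp add: Re_exp del: of_real_mult)
    moreover have "\<bar>(a - a') * t\<bar> = pi" using ne by (simp add: t_def abs_mult)
    ultimately show False by simp
  qed
qed

text \<open>The semigroup law at \<open>z = 1\<close> yields \<open>a\<close> and \<open>b\<close>
  for all times together. For each fixed \<open>t\<close> the logarithm of \<open>\<phi> t\<close>
  is affine in \<open>z\<close>, and its coefficients are then matched with \<open>a\<close> and
  \<open>b\<close> by evaluating at \<open>z = 1\<close>.\<close>

lemma semigroup_symbol_form:
  fixes \<phi> :: "real \<Rightarrow> complex \<Rightarrow> complex"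
  assumes hol: "\<And>t. 0 \<le> t \<Longrightarrow> \<phi> t holomorphic_on {z. 0 < Re z}"
    and cont: "continuous_on {0..} (\<lambda>t. \<phi> t 1)"
    and zero: "\<phi> 0 1 = 1"
    and add: "\<And>s t. 0 \<le> s \<Longrightarrow> 0 \<le> t \<Longrightarrow> \<phi> (s + t) 1 = \<phi> s 1 * \<phi> t 1"
    and le: "\<And>t z. 0 \<le> t \<Longrightarrow> 0 < Re z \<Longrightarrow> cmod (\<phi> t z) \<le> 1"
    and ge: "\<And>t z. 0 \<le> t \<Longrightarrow> 0 < Re z \<Longrightarrow> exp (- (t * Re z)) \<le> cmod (\<phi> t z)"
  shows "\<exists>a b. 0 \<le> b \<and> (\<forall>t\<ge>0. \<forall>z. 0 < Re z \<longrightarrow>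
    \<phi> t z = exp (\<i> * of_real (a * t)) * exp (- (z * of_real (b * t))))"
proof -
  obtain c where c: "\<And>t. 0 \<le> t \<Longrightarrow> \<phi> t 1 = exp (c * of_real t)"
    using continuous_semigroup_hom_eq_exp[OF cont zero add] by auto
  define a where "a = Im c"
  define b where "b = - Re c"
  have \<phi>1: "\<phi> t 1 = exp (\<i> * of_real (a * t)) * exp (- of_real (b * t))" if "0 \<le> t" for t
  proof -
    have "c * of_real t = \<i> * of_real (a * t) + - of_real (b * t)"
      by (simp add: complex_eq_iff a_def b_def)
    then show ?thesis by (simp add: c[OF that] flip: exp_add)
  qed
  have "0 \<le> b"
    using le[of 1 1] \<phi>1[of 1] by (simp add: norm_mult)
  moreover have "\<phi> t z = exp (\<i> * of_real (a * t)) * exp (- (z * of_real (b * t)))"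
    if t: "0 \<le> t" and z: "0 < Re z" for t z
  proof -
    have nz: "\<phi> t w \<noteq> 0" if "w \<in> {z. 0 < Re z}" for w
    proof
      assume "\<phi> t w = 0"
      then show False using ge[OF t, of w] that exp_gt_zero[of "- (t * Re w)"] by simp
    qed
    \<comment> \<open>The lower bound excludes zeros, so a holomorphic logarithm exists on the
      convex half-plane.\<close>
    obtain g where g: "g holomorphic_on {z. 0 < Re z}" "\<And>w. 0 < Re w \<Longrightarrow> exp (g w) = \<phi> t w"
      using holomorphic_logarithm_exists[OF convex_halfspace_Re_gt open_halfspace_Re_gt hol[OF t] nz, of 1]
      by auto
    have norm_g: "cmod (\<phi> t w) = exp (Re (g w))" if "0 < Re w" for w
      using g(2)[OF that] by (metis norm_exp_eq_Re)
    have "(\<lambda>w. - g w) holomorphic_on {z. 0 < Re z}"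
      by (intro holomorphic_intros g)
    moreover have "0 \<le> Re (- g w)" if "0 < Re w" for w
      using le[OF t that] norm_g[OF that] by simp
    moreover have "Re (- g w) \<le> t * Re w" if "0 < Re w" for w
      using ge[OF t that] norm_g[OF that] by simp
    ultimately obtain p q :: real where pq: "\<And>w. 0 < Re w \<Longrightarrow> - g w = \<i> * of_real p + of_real q * w"
      using right_half_plane_affine[of "\<lambda>w. - g w" t] by auto
    have \<phi>t: "\<phi> t w = exp (- (\<i> * of_real p)) * exp (- (w * of_real q))" if "0 < Re w" for w
    proof -
      have "g w = - (\<i> * of_real p) + - (w * of_real q)"
        using pq[OF that] by (simp add: minus_equation_iff[of "g w"] algebra_simps)
      then show ?thesis using g(2)[OF that] by (simp flip: exp_add)
    qed
    have eq: "exp (- (\<i> * of_real p)) * exp (- of_real q) = exp (\<i> * of_real (a * t)) * exp (- of_real (b * t))"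
      using \<phi>t[of 1] \<phi>1[OF t] by simp
    \<comment> \<open>Moduli identify \<open>q\<close>; \<open>p\<close> is known only modulo
      \<open>2 * pi\<close>, so the phases are compared as exponentials.\<close>
    have "exp (- q) = exp (- (b * t))"
      using arg_cong[where f = cmod, OF eq] by (simp add: norm_mult)
    then have q: "q = b * t" by simp
    with eq have "exp (- (\<i> * of_real p)) = exp (\<i> * of_real (a * t))" by simp
    then show ?thesis using \<phi>t[OF z] q by simp
  qed
  ultimately show ?thesis by blast
qed

section \<open>Contractions and their commutation, up to almost-everywhere equality\<close>

lemma ae_eq_refl [simp]: "ae_eq f f"
  by (simp add: ae_eq_def)

lemma ae_eq_sym: "ae_eq f g \<Longrightarrow> ae_eq g f"
  by (auto simp: ae_eq_def elim: eventually_mono)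

lemma ae_eq_trans [trans]: "ae_eq f g \<Longrightarrow> ae_eq g h \<Longrightarrow> ae_eq f h"
  unfolding ae_eq_def by (elim AE_mp) auto

lemma contraction_op_L2: "contraction_op T \<Longrightarrow> f \<in> L2 \<Longrightarrow> T f \<in> L2"
  by (simp add: contraction_op_def)

lemma contraction_op_cong:
  "contraction_op T \<Longrightarrow> ae_eq f g \<Longrightarrow> f \<in> L2 \<Longrightarrow> g \<in> L2 \<Longrightarrow> ae_eq (T f) (T g)"
  by (simp add: contraction_op_def)

lemma contraction_op_add_scaled:
  "contraction_op T \<Longrightarrow> f \<in> L2 \<Longrightarrow> g \<in> L2 \<Longrightarrow> ae_eq (T (\<lambda>x. f x + c * g x)) (\<lambda>x. T f x + c * T g x)"
  by (simp add: contraction_op_def)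

lemma contraction_op_norm: "contraction_op T \<Longrightarrow> f \<in> L2 \<Longrightarrow> l2norm (T f) \<le> l2norm f"
  by (simp add: contraction_op_def)

lemma op_eqD: "op_eq T U \<Longrightarrow> f \<in> L2 \<Longrightarrow> ae_eq (T f) (U f)"
  by (simp add: op_eq_def)

lemma contraction_op_id: "contraction_op id"
  by (simp add: contraction_op_def)

lemma contraction_op_comp:
  assumes T: "contraction_op T" and U: "contraction_op U"
  shows "contraction_op (T \<circ> U)"
  unfolding contraction_op_def
proof (intro conjI ballI allI impI)
  fix f g c assume f: "f \<in> L2" and g: "g \<in> L2"
  show "(T \<circ> U) f \<in> L2" using T U f by (simp add: contraction_op_L2)
  show "ae_eq ((T \<circ> U) f) ((T \<circ> U) g)" if "ae_eq f g"
    using that T U f g by (simp add: contraction_op_cong contraction_op_L2)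
  have "ae_eq ((T \<circ> U) (\<lambda>x. f x + c * g x)) (T (\<lambda>x. U f x + c * U g x))"
    using T U f g by (simp add: contraction_op_cong contraction_op_L2 contraction_op_add_scaled L2_add_scaled)
  also have "ae_eq \<dots> (\<lambda>x. (T \<circ> U) f x + c * (T \<circ> U) g x)"
    using T U f g by (simp add: contraction_op_L2 contraction_op_add_scaled)
  finally show "ae_eq ((T \<circ> U) (\<lambda>x. f x + c * g x)) (\<lambda>x. (T \<circ> U) f x + c * (T \<circ> U) g x)" .
  show "l2norm ((T \<circ> U) f) \<le> l2norm f"
    using contraction_op_norm[OF T contraction_op_L2[OF U f]] contraction_op_norm[OF U f] by simp
qed

definition commuting :: "op \<Rightarrow> op \<Rightarrow> bool" where
  "commuting A B \<longleftrightarrow> op_eq (A \<circ> B) (B \<circ> A)"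

lemma commuting_sym: "commuting A B \<Longrightarrow> commuting B A"
  by (auto simp: commuting_def op_eq_def intro: ae_eq_sym)

lemma commuting_op_eq_id: "contraction_op A \<Longrightarrow> op_eq B id \<Longrightarrow> (\<And>f. f \<in> L2 \<Longrightarrow> B f \<in> L2) \<Longrightarrow> commuting A B"
proof -
  assume A: "contraction_op A" and eq: "op_eq B id" and B: "\<And>f. f \<in> L2 \<Longrightarrow> B f \<in> L2"
  have "ae_eq (A (B f)) (B (A f))" if f: "f \<in> L2" for f
  proof -
    have "ae_eq (A (B f)) (A f)"
      using contraction_op_cong[OF A _ B[OF f] f] op_eqD[OF eq f] by simp
    also have "ae_eq \<dots> (B (A f))"
      using ae_eq_sym[OF op_eqD[OF eq contraction_op_L2[OF A f]]] by simp
    finally show ?thesis .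
  qed
  then show ?thesis by (simp add: commuting_def op_eq_def)
qed

lemma commuting_comp:
  assumes A: "contraction_op A" and B: "contraction_op B" and C: "\<And>f. f \<in> L2 \<Longrightarrow> C f \<in> L2"
    and AB: "commuting A B" and AC: "commuting A C"
  shows "commuting A (B \<circ> C)"
  unfolding commuting_def op_eq_def
proof
  fix f assume f: "f \<in> L2"
  have "ae_eq (A (B (C f))) (B (A (C f)))"
    using AB C[OF f] by (simp add: commuting_def op_eq_def)
  also have "ae_eq \<dots> (B (C (A f)))"
    using AC A B C f by (intro contraction_op_cong[OF B]) (simp_all add: commuting_def op_eq_def contraction_op_L2)
  finally show "ae_eq ((A \<circ> (B \<circ> C)) f) ((B \<circ> C \<circ> A) f)" by simp
qed

lemma commuting_op_eq:
  assumes A: "contraction_op A" and B: "\<And>f. f \<in> L2 \<Longrightarrow> B f \<in> L2" and C: "\<And>f. f \<in> L2 \<Longrightarrow> C f \<in> L2"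
    and AB: "commuting A B" and eq: "op_eq C B"
  shows "commuting A C"
  unfolding commuting_def op_eq_def
proof
  fix f assume f: "f \<in> L2"
  have "ae_eq (A (C f)) (A (B f))"
    using eq f by (intro contraction_op_cong[OF A]) (simp_all add: op_eq_def B C)
  also have "ae_eq \<dots> (B (A f))"
    using AB f by (simp add: commuting_def op_eq_def)
  also have "ae_eq \<dots> (C (A f))"
    using eq contraction_op_L2[OF A f] by (auto simp: op_eq_def intro: ae_eq_sym)
  finally show "ae_eq ((A \<circ> C) f) ((C \<circ> A) f)" by simp
qed

text \<open>A contraction commuting with sufficiently many shifts is diagonalised by the Laplace
  transform: \<open>m s = laplace z (T 1\<^bsub>[0, s)\<^esub>)\<close> satisfies
  \<open>m (s + t) = m s + e\<^bsup>-zs\<^esup> m t\<close>, and exchanging \<open>s\<close> and \<open>t\<close> forces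
  \<open>m s\<close> to be proportional to \<open>1 - e\<^bsup>-zs\<^esup>\<close>.\<close>

lemma laplace_symbol_exists:
  assumes T: "contraction_op T" and z: "0 < Re z"
    and D: "\<And>s. s \<in> D \<Longrightarrow> 0 \<le> s \<and> commuting T (shift s)"
    and dense: "\<And>s. 0 \<le> s \<Longrightarrow> \<exists>S. (\<forall>n::nat. S n \<in> D \<and> S n \<le> s) \<and> S \<longlonglongrightarrow> s"
  shows "\<exists>c. \<forall>f\<in>L2. laplace z (T f) = c * laplace z f"
proof -
  note T_L2 = contraction_op_L2[OF T]
  define M where "M = (\<lambda>f. laplace z (T f))"
  have M_add: "M (\<lambda>x. f x + c * g x) = M f + c * M g" if "f \<in> L2" "g \<in> L2" for f g c
    unfolding M_def
    using laplace_cong[OF z contraction_op_add_scaled[OF T that]] that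
    by (simp add: T_L2 L2_add_scaled laplace_add_scaled z)
  have M_shift: "M (shift s f) = exp (- (z * of_real s)) * M f" if "s \<in> D" "f \<in> L2" for s f
  proof -
    have "ae_eq (T (shift s f)) (shift s (T f))"
      using D[OF that(1)] that(2) by (simp add: commuting_def op_eq_def)
    then have "M (shift s f) = laplace z (shift s (T f))"
      unfolding M_def using D[OF that(1)] that(2) by (intro laplace_cong[OF z] T_L2 shift_L2) auto
    then show ?thesis using D[OF that(1)] by (simp add: laplace_shift M_def)
  qed
  \<comment> \<open>Linearity and contractivity make \<open>M\<close> continuous for the norm, as
    density arguments require.\<close>
  have M_tendsto: "(\<lambda>n. M (F n)) \<longlonglongrightarrow> M f"
    if F: "\<And>n. F n \<in> L2" and f: "f \<in> L2" and lim: "(\<lambda>n. l2norm (\<lambda>x. F n x - f x)) \<longlonglongrightarrow> 0" for F f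
    unfolding M_def
  proof (rule laplace_tendsto)
    have le: "l2norm (\<lambda>x. T (F n) x - T f x) \<le> l2norm (\<lambda>x. F n x - f x)" for n
    proof -
      have "ae_eq (T (\<lambda>x. F n x - f x)) (\<lambda>x. T (F n) x - T f x)"
        using contraction_op_add_scaled[OF T F f, of n "-1"] by simp
      then have "l2norm (\<lambda>x. T (F n) x - T f x) = l2norm (T (\<lambda>x. F n x - f x))"
        by (intro l2norm_cong[symmetric] T_L2 L2_diff F f)
      then show ?thesis using contraction_op_norm[OF T L2_diff[OF F f]] by simp
    qed
    show "(\<lambda>n. l2norm (\<lambda>x. T (F n) x - T f x)) \<longlonglongrightarrow> 0"
      by (rule Lim_null_comparison[OF _ lim]) (use le in simp)
  qed (use F f z T_L2 in auto)
  define m where "m = (\<lambda>s. M (indicator {0..<s}))"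
  have m_add: "m (s + t) = m s + exp (- (z * of_real s)) * m t" if "s \<in> D" "0 \<le> t" for s t
  proof -
    have "indicator {0..<s + t} = (\<lambda>x. indicator {0..<s} x + 1 * shift s (indicator {0..<t}) x :: complex)"
      using D[OF that(1)] that(2) by (auto simp: shift_def indicator_def fun_eq_iff)
    then have "m (s + t) = m s + 1 * M (shift s (indicator {0..<t}))"
      unfolding m_def using M_add[of "indicator {0..<s}" "shift s (indicator {0..<t})" 1]
        shift_L2[OF L2_indicator_interval] L2_indicator_interval D[OF that(1)]
      by simp
    then show ?thesis using M_shift[OF that(1) L2_indicator_interval] by (simp add: m_def)
  qed
  \<comment> \<open>A fixed positive reference time; approximating \<open>1\<close> from
    \<open>D\<close> provides one.\<close>
  obtain r where r: "r \<in> D" "0 < r"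
  proof -
    obtain S where S: "\<forall>n::nat. S n \<in> D \<and> S n \<le> 1" "S \<longlonglongrightarrow> 1" using dense[of 1] by auto
    then have "\<forall>\<^sub>F n in sequentially. 0 < S n" by (intro order_tendstoD) auto
    then show ?thesis using S(1) that by (auto simp: eventually_sequentially)
  qed
  have r0: "1 - exp (- (z * of_real r)) \<noteq> 0"
  proof
    assume "1 - exp (- (z * of_real r)) = 0"
    then have "cmod (exp (- (z * of_real r))) = 1" by simp
    then show False using r z by simp
  qed
  \<comment> \<open>The quotient of \<open>m r\<close> by the transform of the indicator of
    \<open>{0..<r}\<close>, the only possible multiplier.\<close>
  define c where "c = m r * z / (1 - exp (- (z * of_real r)))"
  have m_D: "m s = c * laplace z (indicator {0..<s})" if s: "s \<in> D" for s
  proof -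
    have "m s + exp (- (z * of_real s)) * m r = m r + exp (- (z * of_real r)) * m s"
      using m_add[OF s, of r] m_add[OF r(1), of s] r D[OF s] by (simp add: add.commute)
    then have "m s * (1 - exp (- (z * of_real r))) = m r * (1 - exp (- (z * of_real s)))"
      by (simp add: algebra_simps)
    then have "m s = m r * (1 - exp (- (z * of_real s))) / (1 - exp (- (z * of_real r)))"
      using r0 by (simp add: eq_divide_eq)
    moreover have "z \<noteq> 0" using z by auto
    ultimately show ?thesis
      using D[OF s] by (simp add: c_def laplace_indicator z)
  qed
  have "M f = c * laplace z f" if "f \<in> L2" for f
    using that
  proof (induction rule: L2_induct)
    case (interval s)
    \<comment> \<open>Approximation from below gives pointwise convergence of the half-open
      indicators everywhere, including at \<open>x = s\<close>, and makes the limit itself a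
      majorant.\<close>
    obtain S where S: "\<And>n::nat. S n \<in> D" "\<And>n. S n \<le> s" "S \<longlonglongrightarrow> s" using dense[OF interval] by auto
    have lim: "(\<lambda>n. indicator {0..<S n} x :: complex) \<longlonglongrightarrow> indicator {0..<s} x" if "0 \<le> x" for x
    proof (cases "x < s")
      case True
      then have "\<forall>\<^sub>F n in sequentially. x < S n" by (rule order_tendstoD(1)[OF S(3)])
      then have "\<forall>\<^sub>F n in sequentially. (indicator {0..<s} x :: complex) = indicator {0..<S n} x"
        by eventually_elim (use True that in auto)
      then show ?thesis by (rule Lim_transform_eventually[OF tendsto_const])
    next
      case False
      then have "indicator {0..<S n} x = (0 :: complex)" for n using S(2)[of n] by auto
      then show ?thesis using False by simp
    qed
    have le: "cmod (indicator {0..<S n} x) \<le> cmod (indicator {0..<s} x)" for n x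
      using S(2)[of n] by (auto simp: indicator_def)
    note dc = L2_dominated_convergence[OF _ _ L2_indicator_interval le lim]
    have conv: "(\<lambda>n. l2norm (\<lambda>x. indicator {0..<S n} x - indicator {0..<s} x)) \<longlonglongrightarrow> 0"
      by (rule dc(1)) auto
    have "(\<lambda>n. m (S n)) \<longlonglongrightarrow> M (indicator {0..<s})"
      unfolding m_def by (rule M_tendsto[OF L2_indicator_interval L2_indicator_interval conv])
    moreover have "(\<lambda>n. m (S n)) \<longlonglongrightarrow> c * laplace z (indicator {0..<s})"
      unfolding m_D[OF S(1)]
      by (intro tendsto_intros laplace_tendsto[OF L2_indicator_interval L2_indicator_interval z conv])
    ultimately show ?case by (rule LIMSEQ_unique)
  next
    case (add_scaled f g a)
    then show ?case by (simp add: M_add laplace_add_scaled z algebra_simps)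
  next
    case (limit F f)
    have "(\<lambda>n. M (F n)) \<longlonglongrightarrow> M f" by (rule M_tendsto) fact+
    moreover have "(\<lambda>n. M (F n)) \<longlonglongrightarrow> c * laplace z f"
      unfolding limit.IH by (intro tendsto_intros laplace_tendsto[OF limit.hyps(1,2) z limit.hyps(3)])
    ultimately show ?case by (rule LIMSEQ_unique)
  qed
  then show ?thesis by (auto simp: M_def)
qed

lemma foldr_contraction_op: "(\<And>j. j \<in> set xs \<Longrightarrow> contraction_op (W j)) \<Longrightarrow> contraction_op (foldr (\<lambda>j U. W j \<circ> U) xs id)"
  by (induction xs) (simp_all add: contraction_op_id contraction_op_comp)

lemma commuting_foldr:
  assumes "contraction_op A" and "\<And>j. j \<in> set xs \<Longrightarrow> contraction_op (W j)"
    and "\<And>j. j \<in> set xs \<Longrightarrow> commuting A (W j)"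
  shows "commuting A (foldr (\<lambda>j U. W j \<circ> U) xs id)"
  using assms
proof (induction xs)
  case (Cons x xs)
  then have xs: "contraction_op (foldr (\<lambda>j U. W j \<circ> U) xs id)" by (intro foldr_contraction_op) auto
  have "commuting A (W x \<circ> foldr (\<lambda>j U. W j \<circ> U) xs id)"
  proof (rule commuting_comp[OF Cons.prems(1) _ contraction_op_L2[OF xs]])
    show "commuting A (foldr (\<lambda>j U. W j \<circ> U) xs id)"
      by (rule Cons.IH) (use Cons.prems in auto)
  qed (use Cons.prems in auto)
  then show ?case by (simp only: foldr.simps comp_def)
qed (simp add: commuting_def op_eq_def)

section \<open>Commutation of the factors with shifts\<close>

lemma shift_shift: "0 \<le> s \<Longrightarrow> 0 \<le> t \<Longrightarrow> shift s (shift t f) = shift (s + t) f"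
  by (auto simp: shift_def fun_eq_iff algebra_simps)

lemma semigroup_contraction_op: "semigroup V \<Longrightarrow> 0 \<le> t \<Longrightarrow> contraction_op (V t)"
  by (simp add: semigroup_def)

lemma semigroup_zero: "semigroup V \<Longrightarrow> op_eq (V 0) id"
  by (simp add: semigroup_def)

lemma semigroup_add: "semigroup V \<Longrightarrow> 0 \<le> s \<Longrightarrow> 0 \<le> t \<Longrightarrow> op_eq (V (s + t)) (V s \<circ> V t)"
  by (simp add: semigroup_def)

lemma factorization_semigroup: "factorization V n \<Longrightarrow> j < n \<Longrightarrow> semigroup (V j)"
  by (simp add: factorization_def)

text \<open>The shift agrees with a product of contractions and inherits contractivity and
  compatibility with null sets from it; linearity holds pointwise. This makes shifts admissible in
  the commutation lemmas.\<close>

lemma factorization_contraction_op_shift: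
  assumes fac: "factorization V n" and u: "0 \<le> u"
  shows "contraction_op (shift u)"
proof -
  note V = semigroup_contraction_op[OF factorization_semigroup[OF fac]]
  let ?P = "prod_ops V n u"
  have eq: "op_eq (shift u) ?P" using fac u by (simp add: factorization_def)
  have P: "contraction_op ?P"
    unfolding prod_ops_def using V u by (intro foldr_contraction_op) auto
  note S_L2 = shift_L2[OF _ u] and P_L2 = contraction_op_L2[OF P]
  show ?thesis
    unfolding contraction_op_def
  proof (intro conjI ballI allI impI)
    fix f g c assume f: "f \<in> L2" and g: "g \<in> L2"
    show "shift u f \<in> L2" by (rule S_L2[OF f])
    show "ae_eq (shift u f) (shift u g)" if "ae_eq f g"
      using op_eqD[OF eq f] contraction_op_cong[OF P that f g] ae_eq_sym[OF op_eqD[OF eq g]]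
      by (blast intro: ae_eq_trans)
    show "ae_eq (shift u (\<lambda>x. f x + c * g x)) (\<lambda>x. shift u f x + c * shift u g x)"
      by (auto simp: ae_eq_def shift_def)
    show "l2norm (shift u f) \<le> l2norm f"
      using l2norm_cong[OF op_eqD[OF eq f] S_L2[OF f] P_L2[OF f]] contraction_op_norm[OF P f] by simp
  qed
qed

text \<open>The factors are assumed to commute only at equal times. At time \<open>u\<close> this
  makes \<open>V j u\<close> commute with the whole product, hence with \<open>shift u\<close>;
  taking powers on both sides then gives commensurable times.\<close>

lemma factorization_commuting_shift:
  assumes fac: "factorization V n" and j: "j < n" and u: "0 \<le> u"
  shows "commuting (V j (real q * u)) (shift (real p * u))"
proof -
  note V = semigroup_contraction_op[OF factorization_semigroup[OF fac]]
  note Vj = factorization_semigroup[OF fac j]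
  have P: "contraction_op (prod_ops V n u)"
    unfolding prod_ops_def using V u by (intro foldr_contraction_op) auto
  have shift: "contraction_op (shift s)" if "0 \<le> s" for s
    by (rule factorization_contraction_op_shift[OF fac that])
  have j_prod: "commuting (V j u) (prod_ops V n u)"
    unfolding prod_ops_def using fac u j V
    by (intro commuting_foldr) (auto simp: factorization_def commuting_def)
  have u_u: "commuting (V j u) (shift u)"
    by (rule commuting_op_eq[OF V[OF j u] contraction_op_L2[OF P] shift_L2[OF _ u] j_prod])
       (use fac u in \<open>simp_all add: factorization_def\<close>)
  have u_p: "commuting (V j u) (shift (real p * u))"
  proof (induction p)
    case 0
    have "op_eq (shift 0) id" by (auto simp: op_eq_def ae_eq_def shift_def)
    then show ?case using commuting_op_eq_id[OF V[OF j u] _ shift_L2] by simp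
  next
    case (Suc p)
    have "commuting (V j u) (shift u \<circ> shift (real p * u))"
      by (rule commuting_comp[OF V[OF j u] shift[OF u] shift_L2 u_u Suc]) (use u in auto)
    moreover have "shift u \<circ> shift (real p * u) = shift (real (Suc p) * u)"
      using u by (simp add: fun_eq_iff shift_shift algebra_simps)
    ultimately show ?case by simp
  qed
  \<comment> \<open>The roles are now exchanged: the shift stays fixed while the semigroup law
    builds up multiples of \<open>u\<close> in \<open>V j\<close>.\<close>
  have shift_p: "contraction_op (shift (real p * u))" using shift u by simp
  show ?thesis
  proof (induction q)
    case 0
    then show ?case
      using commuting_sym[OF commuting_op_eq_id[OF shift_p semigroup_zero[OF Vj]]] V[OF j] contraction_op_L2 by auto
  next
    case (Suc q)
    have qu: "0 \<le> real q * u" using u by simp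
    have "commuting (shift (real p * u)) (V j u \<circ> V j (real q * u))"
      by (rule commuting_comp[OF shift_p V[OF j u] contraction_op_L2[OF V[OF j qu]]
            commuting_sym[OF u_p] commuting_sym[OF Suc]])
    from commuting_op_eq[OF shift_p contraction_op_L2[OF contraction_op_comp[OF V[OF j u] V[OF j qu]]]
            contraction_op_L2[OF V[OF j]] this semigroup_add[OF Vj u qu]]
    have "commuting (shift (real p * u)) (V j (u + real q * u))"
      using u by simp
    from commuting_sym[OF this] show ?case by (simp add: algebra_simps)
  qed
qed

text \<open>Taking \<open>u = t / (q + 1)\<close> shows that \<open>V j t\<close> commutes with
  shifts by all nonnegative rational multiples of \<open>t\<close>. For positive \<open>t\<close>
  these are dense in the half-line, so \<open>laplace_symbol_exists\<close> applies.\<close>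

lemma factorization_symbol_exists:
  assumes fac: "factorization V n" and j: "j < n" and t: "0 \<le> t" and z: "0 < Re z"
  shows "\<exists>c. \<forall>f\<in>L2. laplace z (V j t f) = c * laplace z f"
\<comment> \<open>At \<open>t = 0\<close> the set of multiples collapses to \<open>{0}\<close>, but
  there the operator is the identity.\<close>
proof (cases "t = 0")
  case True
  note Vj = factorization_semigroup[OF fac j]
  have "laplace z (V j 0 f) = 1 * laplace z f" if "f \<in> L2" for f
    using laplace_cong[OF z op_eqD[OF semigroup_zero[OF Vj] that]] that
      contraction_op_L2[OF semigroup_contraction_op[OF Vj]] by simp
  then show ?thesis using True by metis
next
  case False
  with t have t: "0 < t" by simp
  define D where "D = {real p * (t / real (Suc q)) |p q. True}"
  show ?thesis
  proof (rule laplace_symbol_exists[where D = D])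
    show "contraction_op (V j t)"
      using semigroup_contraction_op[OF factorization_semigroup[OF fac j]] t by simp
    fix s assume "s \<in> D"
    then obtain p q where s: "s = real p * (t / real (Suc q))" by (auto simp: D_def)
    have "real (Suc q) * (t / real (Suc q)) = t" by (simp del: of_nat_Suc)
    then show "0 \<le> s \<and> commuting (V j t) (shift s)"
      using factorization_commuting_shift[OF fac j, of "t / real (Suc q)" "Suc q" p] t s by simp
  next
    fix s :: real assume s: "0 \<le> s"
    \<comment> \<open>The largest multiple of \<open>t / (n + 1)\<close> not exceeding
      \<open>s\<close>.\<close>
    define S where "S = (\<lambda>n. real (nat \<lfloor>s * real (Suc n) / t\<rfloor>) * (t / real (Suc n)))"
    have S_le: "S n \<le> s" and S_ge: "s - t / real (Suc n) \<le> S n" for n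
    proof -
      have pos: "0 < t / real (Suc n)" using t by simp
      have nn: "0 \<le> s * real (Suc n) / t" using s t by simp
      define k where "k = real (nat \<lfloor>s * real (Suc n) / t\<rfloor>)"
      have k: "k \<le> s * real (Suc n) / t" "s * real (Suc n) / t - 1 \<le> k"
        using nn by (simp_all add: k_def)
      have eq: "s * real (Suc n) / t * (t / real (Suc n)) = s" using t by simp
      show "S n \<le> s"
        using mult_right_mono[OF k(1) less_imp_le[OF pos]] eq by (simp add: S_def k_def)
      show "s - t / real (Suc n) \<le> S n"
        using mult_right_mono[OF k(2) less_imp_le[OF pos], unfolded left_diff_distrib eq]
        by (simp add: S_def k_def)
    qed
    have lim: "(\<lambda>n. s - t / real (Suc n)) \<longlonglongrightarrow> s - 0"
      unfolding divide_inverse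
      by (rule tendsto_diff[OF tendsto_const tendsto_mult_right_zero[OF LIMSEQ_inverse_real_of_nat]])
    have "S \<longlonglongrightarrow> s"
      by (rule tendsto_sandwich[OF always_eventually always_eventually lim[unfolded diff_zero] tendsto_const])
         (blast intro: S_le S_ge)+
    moreover have "S n \<in> D" for n unfolding S_def D_def by blast
    ultimately show "\<exists>S. (\<forall>n. S n \<in> D \<and> S n \<le> s) \<and> S \<longlonglongrightarrow> s" using S_le by blast
  qed (rule z)
qed

section \<open>Factorizations of the shift semigroup\<close>

lemma laplace_prod_ops:
  assumes W: "\<And>j. j \<in> set xs \<Longrightarrow> contraction_op (W j)"
    and sym: "\<And>j f. j \<in> set xs \<Longrightarrow> f \<in> L2 \<Longrightarrow> laplace z (W j f) = c j * laplace z f"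
    and f: "f \<in> L2"
  shows "laplace z (foldr (\<lambda>j U. W j \<circ> U) xs id f) = (\<Prod>j\<leftarrow>xs. c j) * laplace z f"
  using W sym
proof (induction xs)
  case (Cons x xs)
  let ?U = "foldr (\<lambda>j U. W j \<circ> U) xs id"
  have "?U f \<in> L2"
    by (rule contraction_op_L2[OF foldr_contraction_op f]) (use Cons.prems in auto)
  then have "laplace z (W x (?U f)) = c x * laplace z (?U f)"
    by (intro Cons.prems) auto
  also have "laplace z (?U f) = (\<Prod>j\<leftarrow>xs. c j) * laplace z f"
    by (rule Cons.IH) (use Cons.prems in auto)
  finally show ?case by (simp add: comp_def)
qed simp

text \<open>Both sides are the multiplier of the shift by \<open>t\<close>; one function with
  nonvanishing transform at \<open>z\<close> suffices to cancel.\<close>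

lemma factorization_symbol_prod:
  assumes fac: "factorization V n" and t: "0 \<le> t" and z: "0 < Re z"
    and sym: "\<And>j f. j < n \<Longrightarrow> f \<in> L2 \<Longrightarrow> laplace z (V j t f) = c j * laplace z f"
    and f: "f \<in> L2" "laplace z f \<noteq> 0"
  shows "(\<Prod>j<n. c j) = exp (- (z * of_real t))"
proof -
  note contr = semigroup_contraction_op[OF factorization_semigroup[OF fac]]
  have P: "contraction_op (prod_ops V n t)"
    unfolding prod_ops_def by (rule foldr_contraction_op) (use contr t in auto)
  have "op_eq (shift t) (prod_ops V n t)" using fac t by (simp add: factorization_def)
  from laplace_cong[OF z op_eqD[OF this f(1)] shift_L2[OF f(1) t] contraction_op_L2[OF P f(1)]]
  have "exp (- (z * of_real t)) * laplace z f = laplace z (prod_ops V n t f)"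
    by (simp add: laplace_shift t)
  also have "\<dots> = (\<Prod>j\<leftarrow>[0..<n]. c j) * laplace z f"
    unfolding prod_ops_def by (rule laplace_prod_ops) (use contr sym t f in auto)
  also have "(\<Prod>j\<leftarrow>[0..<n]. c j) = (\<Prod>j<n. c j)"
    by (simp add: prod.distinct_set_conv_list[symmetric] atLeast0LessThan)
  finally show ?thesis using f(2) by simp
qed

text \<open>The work lies in checking the hypotheses of \<open>semigroup_symbol_form\<close> for the
  multipliers of the factors: holomorphy, continuity at \<open>z = 1\<close>, and the two-sided
  modulus bound.\<close>

lemma factorization_symbol_form:
  assumes fac: "factorization V n" and j: "j < n"
  shows "\<exists>a b. 0 \<le> b \<and> (\<forall>t\<ge>0. \<forall>z. 0 < Re z \<longrightarrow> (\<forall>f\<in>L2.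
    laplace z (V j t f) = exp (\<i> * of_real (a * t)) * exp (- (z * of_real (b * t))) * laplace z f))"
proof -
  define e :: fn where "e = indicator {0..<1}"
  have e: "e \<in> L2" unfolding e_def by (rule L2_indicator_interval)
  have e0: "laplace z e \<noteq> 0" if z: "0 < Re z" for z
  proof
    assume "laplace z e = 0"
    then have "exp (- z) = 1" using z laplace_indicator[OF z, of 1] by (auto simp: e_def)
    then have "cmod (exp (- z)) = 1" by simp
    then show False using z by simp
  qed
  \<comment> \<open>Reading the multiplier off a test function whose transform has no zeros gives an
    explicit formula, from which holomorphy in \<open>z\<close> is visible.\<close>
  define \<phi> where "\<phi> = (\<lambda>k t z. laplace z (V k t e) / laplace z e)"
  note contr = semigroup_contraction_op[OF factorization_semigroup[OF fac]]
  have sym: "laplace z (V k t f) = \<phi> k t z * laplace z f"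
    if k: "k < n" and t: "0 \<le> t" and z: "0 < Re z" and f: "f \<in> L2" for k t z f
  proof -
    obtain c where "\<forall>f\<in>L2. laplace z (V k t f) = c * laplace z f"
      using factorization_symbol_exists[OF fac k t z] by blast
    then show ?thesis using e e0[OF z] f by (simp add: \<phi>_def)
  qed
  have add: "\<phi> k (s + t) z = \<phi> k s z * \<phi> k t z"
    if k: "k < n" and s: "0 \<le> s" and t: "0 \<le> t" and z: "0 < Re z" for k s t z
  proof -
    have "laplace z (V k (s + t) e) = laplace z ((V k s \<circ> V k t) e)"
      by (rule laplace_cong[OF z op_eqD[OF semigroup_add[OF factorization_semigroup[OF fac k] s t] e]])
         (use contr[OF k] contraction_op_L2 e s t in simp_all)
    also have "\<dots> = \<phi> k s z * (\<phi> k t z * laplace z e)"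
      using sym k s t z contraction_op_L2[OF contr[OF k t] e] e by simp
    finally show ?thesis using e0[OF z] by (simp add: \<phi>_def)
  qed
  have zero: "\<phi> k 0 z = 1" if k: "k < n" and z: "0 < Re z" for k z
    using laplace_cong[OF z op_eqD[OF semigroup_zero[OF factorization_semigroup[OF fac k]] e]]
      contraction_op_L2[OF contr[OF k] e] e e0[OF z] by (simp add: \<phi>_def)
  have le: "cmod (\<phi> k t z) \<le> 1" if k: "k < n" and t: "0 \<le> t" and z: "0 < Re z" for k t z
  proof (rule ccontr)
    assume "\<not> ?thesis"
    then have gt: "1 < cmod (\<phi> k t z)" by simp
    \<comment> \<open>Contractivity bounds all \<open>\<phi> k s z\<close> by \<open>K\<close>. A
      modulus above \<open>1\<close> at time \<open>t\<close> would be amplified beyond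
      \<open>K\<close> at some multiple of \<open>t\<close>.\<close>
    define K where "K = l2norm (\<lambda>x. exp (- (z * of_real x))) * l2norm e / cmod (laplace z e)"
    have K: "cmod (\<phi> k s z) \<le> K" if s: "0 \<le> s" for s
    proof -
      have "cmod (laplace z (V k s e)) \<le> l2norm (\<lambda>x. exp (- (z * of_real x))) * l2norm (V k s e)"
        by (rule norm_laplace_le[OF z contraction_op_L2[OF contr[OF k s] e]])
      also have "\<dots> \<le> l2norm (\<lambda>x. exp (- (z * of_real x))) * l2norm e"
        by (intro mult_left_mono contraction_op_norm[OF contr[OF k s] e]) simp
      finally show ?thesis by (simp add: \<phi>_def K_def norm_divide divide_right_mono)
    qed
    have pow: "\<phi> k (real m * t) z = \<phi> k t z ^ m" for m
    proof (induction m)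
      case (Suc m)
      have "\<phi> k (t + real m * t) z = \<phi> k t z * \<phi> k t z ^ m"
        using add[OF k t _ z, of "real m * t"] t Suc by simp
      then show ?case by (simp add: algebra_simps)
    qed (simp add: zero k z)
    obtain m where "K < cmod (\<phi> k t z) ^ m" using real_arch_pow[OF gt] by blast
    moreover have "cmod (\<phi> k t z) ^ m \<le> K"
      using K[of "real m * t"] t by (simp add: pow norm_power)
    ultimately show False by simp
  qed
  have prod: "(\<Prod>k<n. \<phi> k t z) = exp (- (z * of_real t))" if t: "0 \<le> t" and z: "0 < Re z" for t z
    by (rule factorization_symbol_prod[OF fac t z sym[OF _ t z] e e0[OF z]])
  \<comment> \<open>The moduli of the \<open>n\<close> multipliers have product
    \<open>exp (- (t * Re z))\<close> and none exceeds \<open>1\<close>, so each is at least the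
    product.\<close>
  have ge: "exp (- (t * Re z)) \<le> cmod (\<phi> j t z)" if t: "0 \<le> t" and z: "0 < Re z" for t z
  proof -
    have "exp (- (t * Re z)) = cmod (\<Prod>k<n. \<phi> k t z)"
      by (simp add: prod[OF t z] mult.commute)
    also have "\<dots> = cmod (\<phi> j t z) * (\<Prod>k\<in>{..<n} - {j}. cmod (\<phi> k t z))"
      using j by (simp add: norm_mult prod.remove[of "{..<n}" j] prod_norm)
    also have "\<dots> \<le> cmod (\<phi> j t z) * 1"
      by (intro mult_left_mono prod_le_1) (use le t z in auto)
    finally show ?thesis by simp
  qed
  have "\<exists>a b. 0 \<le> b \<and> (\<forall>t\<ge>0. \<forall>z. 0 < Re z \<longrightarrow>
    \<phi> j t z = exp (\<i> * of_real (a * t)) * exp (- (z * of_real (b * t))))"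
  proof (rule semigroup_symbol_form)
    show "\<phi> j t holomorphic_on {z. 0 < Re z}" if "0 \<le> t" for t
      unfolding \<phi>_def using e0
      by (intro holomorphic_on_divide laplace_holomorphic contraction_op_L2[OF contr[OF j that]] e) auto
    show "continuous_on {0..} (\<lambda>t. \<phi> j t 1)"
      unfolding \<phi>_def continuous_on_def
    proof (intro ballI tendsto_divide tendsto_const)
      fix t0 :: real assume "t0 \<in> {0..}"
      then have t0: "0 \<le> t0" by simp
      have "((\<lambda>t. l2norm (\<lambda>x. V j t e x - V j t0 e x)) \<longlongrightarrow> 0) (at t0 within {0..})"
        using factorization_semigroup[OF fac j] e t0 by (simp add: semigroup_def)
      \<comment> \<open>\<open>laplace_tendsto\<close> asks for membership in \<open>L2\<close> at
        every index; \<open>max 0 t\<close> ensures it and changes nothing for nonnegative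
        \<open>t\<close>.\<close>
      then have "((\<lambda>t. l2norm (\<lambda>x. V j (max 0 t) e x - V j t0 e x)) \<longlongrightarrow> 0) (at t0 within {0..})"
        by (rule Lim_transform_eventually) (simp add: eventually_at_filter)
      then have "((\<lambda>t. laplace 1 (V j (max 0 t) e)) \<longlongrightarrow> laplace 1 (V j t0 e)) (at t0 within {0..})"
        using contraction_op_L2[OF contr[OF j] e] t0 by (intro laplace_tendsto) auto
      then show "((\<lambda>t. laplace 1 (V j t e)) \<longlongrightarrow> laplace 1 (V j t0 e)) (at t0 within {0..})"
        by (rule Lim_transform_eventually) (simp add: eventually_at_filter)
    qed (use e0 in auto)
  qed (use zero add le ge j in auto)
  then obtain a b where "0 \<le> b" and
    "\<And>t z. 0 \<le> t \<Longrightarrow> 0 < Re z \<Longrightarrow> \<phi> j t z = exp (\<i> * of_real (a * t)) * exp (- (z * of_real (b * t)))"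
    by blast
  then show ?thesis using sym[OF j] by (intro exI[of _ a] exI[of _ b]) auto
qed

text \<open>Vectors are functions on the naturals with indices starting at \<open>0\<close>; setting
  them to zero from \<open>n\<close> on makes uniqueness of the pair meaningful.\<close>

theorem theorem5p3:
  fixes n :: nat and V :: "nat \<Rightarrow> real \<Rightarrow> op"
  assumes "n \<ge> 2" and "factorization V n"
  shows "\<exists>!(a, b). (\<forall>j\<ge>n. a j = 0 \<and> b j = 0) \<and>
            (\<forall>j<n. b j \<ge> 0) \<and>
            (\<Sum>j<n. a j) = 0 \<and>
            majorized n b (\<lambda>j. if j = 0 then 1 else 0) \<and>
            (\<forall>j<n. \<forall>t\<ge>0. op_eq (V j t)
               (\<lambda>f x. exp (\<i> * complex_of_real (a j * t)) * shift (b j * t) f x))"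
proof -
  note fac = assms(2)
  note contr = semigroup_contraction_op[OF factorization_semigroup[OF fac]]
  \<comment> \<open>\<open>symb a b t\<close> is the multiplier that the Laplace transform assigns
    to \<open>model a b t\<close>, the candidate form of a factor.\<close>
  define symb :: "real \<Rightarrow> real \<Rightarrow> real \<Rightarrow> complex \<Rightarrow> complex"
    where "symb = (\<lambda>a b t z. exp (\<i> * of_real (a * t)) * exp (- (z * of_real (b * t))))"
  define model :: "real \<Rightarrow> real \<Rightarrow> real \<Rightarrow> op"
    where "model = (\<lambda>a b t f x. exp (\<i> * complex_of_real (a * t)) * shift (b * t) f x)"
  have model_L2: "model a b t f \<in> L2" if "0 \<le> b" "0 \<le> t" "f \<in> L2" for a b t f
    unfolding model_def using that by (intro L2_scaled shift_L2) auto
  have laplace_model: "laplace z (model a b t f) = symb a b t z * laplace z f"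
    if "0 \<le> b" "0 \<le> t" "f \<in> L2" "0 < Re z" for a b t f z
    using that by (simp add: model_def symb_def laplace_scaled shift_L2 laplace_shift mult.assoc)
  define e :: fn where "e = indicator {0..<1}"
  have e: "e \<in> L2" unfolding e_def by (rule L2_indicator_interval)
  have e0: "laplace 1 e \<noteq> 0"
    using laplace_indicator[of 1 1] by (simp add: e_def exp_eq_1)
  have symb_1_unique: "a = a' \<and> b = b'" if "\<And>t. 0 \<le> t \<Longrightarrow> symb a b t 1 = symb a' b' t 1" for a b a' b'
    using exp_linear_unique[of a b a' b'] that by (simp add: symb_def)
  have "\<forall>j. \<exists>p. j < n \<longrightarrow> 0 \<le> snd p \<and> (\<forall>t\<ge>0. \<forall>z. 0 < Re z \<longrightarrow> (\<forall>f\<in>L2.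
      laplace z (V j t f) = symb (fst p) (snd p) t z * laplace z f))"
    using factorization_symbol_form[OF fac] unfolding symb_def by fastforce
  then obtain p where p: "\<And>j. j < n \<Longrightarrow> 0 \<le> snd (p j)"
    "\<And>j t z f. j < n \<Longrightarrow> 0 \<le> t \<Longrightarrow> 0 < Re z \<Longrightarrow> f \<in> L2 \<Longrightarrow>
      laplace z (V j t f) = symb (fst (p j)) (snd (p j)) t z * laplace z f"
    by metis
  define a where "a = (\<lambda>j. if j < n then fst (p j) else 0)"
  define b where "b = (\<lambda>j. if j < n then snd (p j) else 0)"
  have b_nonneg: "0 \<le> b j" for j using p(1) by (simp add: b_def)
  have sym: "laplace z (V j t f) = symb (a j) (b j) t z * laplace z f"
    if "j < n" "0 \<le> t" "0 < Re z" "f \<in> L2" for j t z f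
    using p(2)[OF that] that(1) by (simp add: a_def b_def)
  \<comment> \<open>The multipliers of the factors multiply to one with summed exponents, which must
    be that of the full shift, namely \<open>symb 0 1\<close>. Uniqueness of the exponents at
    \<open>z = 1\<close> then gives both sums.\<close>
  have "(\<Sum>j<n. a j) = 0 \<and> (\<Sum>j<n. b j) = 1"
  proof (rule symb_1_unique)
    fix t :: real assume t: "0 \<le> t"
    have "(\<Prod>j<n. symb (a j) (b j) t 1) = exp (- (1 * of_real t))"
      by (rule factorization_symbol_prod[OF fac t _ sym[OF _ t] e e0]) auto
    moreover have "(\<Prod>j<n. symb (a j) (b j) t 1) = symb (\<Sum>j<n. a j) (\<Sum>j<n. b j) t 1"
      by (simp add: symb_def prod.distrib sum_distrib_right sum_distrib_left flip: exp_sum sum_negf)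
    ultimately show "symb (\<Sum>j<n. a j) (\<Sum>j<n. b j) t 1 = symb 0 1 t 1" by (simp add: symb_def)
  qed
  then have sum_a: "(\<Sum>j<n. a j) = 0" and sum_b: "(\<Sum>j<n. b j) = 1" by auto
  have maj: "majorized n b (\<lambda>j. if j = 0 then 1 else 0)"
    unfolding majorized_def
  proof (intro conjI ballI)
    \<comment> \<open>Every nonempty initial sum of the comparison vector is \<open>1\<close>, so
      majorization reduces to nonnegativity and total sum \<open>1\<close>.\<close>
    have one: "(\<Sum>j<k. if j = 0 then 1 else 0) = (1 :: real)" if "1 \<le> k" for k :: nat
      using that by (simp add: sum.delta)
    show "(\<Sum>j<n. b j) = (\<Sum>j<n. if j = 0 then 1 else 0)"
      using one assms(1) sum_b by simp
    fix k assume k: "k \<in> {1..n}"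
    then have "(\<Sum>j<k. b j) \<le> (\<Sum>j<n. b j)"
      using b_nonneg by (intro sum_mono2) auto
    then show "(\<Sum>j<k. b j) \<le> (\<Sum>j<k. if j = 0 then 1 else 0)"
      using one k sum_b by simp
  qed
  have op_eq_model: "op_eq (V j t) (model (a j) (b j) t)" if j: "j < n" and t: "0 \<le> t" for j t
    unfolding op_eq_def
  proof
    fix f assume f: "f \<in> L2"
    note L = contraction_op_L2[OF contr[OF j t] f] model_L2[OF b_nonneg t f]
    \<comment> \<open>Equal multipliers give equal transforms, and injectivity of the transform
      turns this into equality of the functions.\<close>
    have "ae_eq (\<lambda>x. V j t f x - model (a j) (b j) t f x) (\<lambda>_. 0)"
    proof (rule laplace_inj)
      show "laplace z (\<lambda>x. V j t f x - model (a j) (b j) t f x) = 0" if "0 < Re z" for z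
        using laplace_diff[OF that L(1) L(2)] sym[OF j t that f] laplace_model[OF b_nonneg t f that] by simp
    qed (intro L2_diff L)
    then show "ae_eq (V j t f) (model (a j) (b j) t f)" by (simp add: ae_eq_def)
  qed
  \<comment> \<open>A competing pair produces the same multipliers on the test function
    \<open>e\<close> at \<open>z = 1\<close>, which already determines the exponents.\<close>
  have unique: "a' = a \<and> b' = b"
    if out: "\<forall>j\<ge>n. a' j = 0 \<and> b' j = 0" and nonneg: "\<forall>j<n. 0 \<le> b' j"
      and eq: "\<forall>j<n. \<forall>t\<ge>0. op_eq (V j t) (model (a' j) (b' j) t)" for a' b'
  proof -
    have "a' j = a j \<and> b' j = b j" for j
    proof (cases "j < n")
      case True
      show ?thesis
      proof (rule symb_1_unique)
        fix t :: real assume t: "0 \<le> t"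
        have b': "0 \<le> b' j" using nonneg True by blast
        have "op_eq (V j t) (model (a' j) (b' j) t)" using eq True t by blast
        from laplace_cong[OF _ op_eqD[OF this e] contraction_op_L2[OF contr[OF True t] e] model_L2[OF b' t e], of 1]
        have "laplace 1 (V j t e) = laplace 1 (model (a' j) (b' j) t e)" by simp
        then show "symb (a' j) (b' j) t 1 = symb (a j) (b j) t 1"
          using sym[OF True t _ e] laplace_model[OF b' t e] e0 by simp
      qed
    next
      case False
      then show ?thesis using out by (simp add: a_def b_def)
    qed
    then show ?thesis by auto
  qed
  have outside: "\<forall>j\<ge>n. a j = 0 \<and> b j = 0" by (simp add: a_def b_def)
  have model_fold: "(\<lambda>f x. exp (\<i> * complex_of_real (\<alpha> * t)) * shift (\<beta> * t) f x) = model \<alpha> \<beta> t" for \<alpha> \<beta> t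
    by (simp add: model_def)
  show ?thesis
    unfolding model_fold
  proof (rule ex1I[of _ "(a, b)"], unfold prod.case)
    show "(\<forall>j\<ge>n. a j = 0 \<and> b j = 0) \<and> (\<forall>j<n. b j \<ge> 0) \<and> (\<Sum>j<n. a j) = 0 \<and>
        majorized n b (\<lambda>j. if j = 0 then 1 else 0) \<and>
        (\<forall>j<n. \<forall>t\<ge>0. op_eq (V j t) (model (a j) (b j) t))"
      using outside b_nonneg sum_a maj op_eq_model by blast
  next
    fix q
    assume "case q of (a, b) \<Rightarrow> (\<forall>j\<ge>n. a j = 0 \<and> b j = 0) \<and> (\<forall>j<n. b j \<ge> 0) \<and> (\<Sum>j<n. a j) = 0 \<and>
        majorized n b (\<lambda>j. if j = 0 then 1 else 0) \<and>
        (\<forall>j<n. \<forall>t\<ge>0. op_eq (V j t) (model (a j) (b j) t))"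
    then show "q = (a, b)"
      using unique[of "fst q" "snd q"] by (cases q) (simp only: prod.case fst_conv snd_conv, blast)
  qed
qed

end
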